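(* Let $\mathcal{L}$ be a minimal Lagrangian surface of $(\mathbb{C}^2,\langle\langle\cdot,\cdot\rangle\rangle_1)$. Then $\mathcal{L}$ is the product $\gamma_1\times J\gamma_2\subset P\oplus JP$, where $\gamma_1$ and $\gamma_2$ are two planar curves contained in a non-Lagrangian (and therefore non-complex) null plane $P$.
   Context: $\mathbb{C}^2$ carries its canonical complex structure $J$ and the pseudo-Hermitian form $\langle\langle\cdot,\cdot\rangle\rangle_1=-dz_1\,d\bar z_1+dz_2\,d\bar z_2=\langle\cdot,\cdot\rangle_2-i\,\omega_1$, where $\langle\cdot,\cdot\rangle_2$ (the real part) is a pseudo-Riemannian metric of signature $(2,2)$ and $\omega_1$ is a symplectic form. A surface is a smooth immersed submanifold of real dimension 2. It is non-degenerate if the metric induced on it by $\langle\cdot,\cdot\rangle_2$ is non-degenerate, and Lagrangian if $\omega_1$ vanishes on it. A non-degenerate surface is minimal if it is a critical point of the volume (area) with respect to compactly supported variations. A plane is a real 2-dimensional linear subspace $P$ of $\mathbb{C}^2$; it is null (totally null) if $\langle\cdot,\cdot\rangle_2|_P=0$, Lagrangian if $\omega_1|_P=0$, and complex if $JP=P$. The product $\gamma_1\times J\gamma_2$ is the set of sums of a point of $\gamma_1\subset P$ and a point of $J\gamma_2\subset JP$.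
   Formalization: "Is the product" is read locally: near every point a piece of the surface is a product of two regular curves γ1 × Jγ2, with one null plane P for each connected component; the global set equality fails, for instance, for a disc in the Lagrangian plane ℝ². *)

theory Defs
  imports "HOL-Analysis.Analysis"
begin

text \<open>
  Meant for open sets \<open>S\<close> only: the derivatives are taken at points of \<open>S\<close> with respect
  to full neighbourhoods. In finite dimension, continuity of all directional derivatives is
  continuity of the derivative.
\<close>

primrec Ck_on :: "nat \<Rightarrow> 'a::euclidean_space set \<Rightarrow> ('a \<Rightarrow> 'b::euclidean_space) \<Rightarrow> bool" where
  "Ck_on 0 S f \<longleftrightarrow> continuous_on S f"
| "Ck_on (Suc k) S f \<longleftrightarrow>
     f differentiable_on S \<and> (\<forall>v. Ck_on k S (\<lambda>x. frechet_derivative f (at x) v))"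

definition smooth_on :: "'a::euclidean_space set \<Rightarrow> ('a \<Rightarrow> 'b::euclidean_space) \<Rightarrow> bool" where
  "smooth_on S f \<longleftrightarrow> (\<forall>k. Ck_on k S f)"

definition J :: "complex^2 \<Rightarrow> complex^2" where
  "J v = \<i> *s v"

definition herm1 :: "complex^2 \<Rightarrow> complex^2 \<Rightarrow> complex" where
  "herm1 v w = - (v$1 * cnj (w$1)) + v$2 * cnj (w$2)"

text \<open>The sign of \<open>\<omega>1\<close> is fixed by \<open>herm1 = metric2 - \<i> \<omega>1\<close>.\<close>

definition metric2 :: "complex^2 \<Rightarrow> complex^2 \<Rightarrow> real" where
  "metric2 v w = Re (herm1 v w)"

definition \<omega>1 :: "complex^2 \<Rightarrow> complex^2 \<Rightarrow> real" where
  "\<omega>1 v w = - Im (herm1 v w)"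

definition real_plane :: "(complex^2) set \<Rightarrow> bool" where
  "real_plane P \<longleftrightarrow> subspace P \<and> dim P = 2"

definition null_plane :: "(complex^2) set \<Rightarrow> bool" where
  "null_plane P \<longleftrightarrow> real_plane P \<and> (\<forall>v\<in>P. \<forall>w\<in>P. metric2 v w = 0)"

definition lagrangian_plane :: "(complex^2) set \<Rightarrow> bool" where
  "lagrangian_plane P \<longleftrightarrow> real_plane P \<and> (\<forall>v\<in>P. \<forall>w\<in>P. \<omega>1 v w = 0)"

definition complex_plane :: "(complex^2) set \<Rightarrow> bool" where
  "complex_plane P \<longleftrightarrow> real_plane P \<and> J ` P = P"

text \<open>
  A chart is given by its inverse: a local parametrization \<open>\<phi>\<close> on an open set \<open>D\<close> of the
  parameter plane. An atlas \<open>A\<close> is a set of such pairs \<open>(D, \<phi>)\<close>; it need not be maximal.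
\<close>

type_synonym 'a chart = "(real^2) set \<times> (real^2 \<Rightarrow> 'a)"

definition smooth_surface :: "'a topology \<Rightarrow> 'a chart set \<Rightarrow> bool" where
  "smooth_surface M A \<longleftrightarrow>
     Hausdorff_space M \<and> second_countable M \<and>
     (\<forall>(D, \<phi>) \<in> A. open D \<and> openin M (\<phi> ` D) \<and>
        homeomorphic_map (top_of_set D) (subtopology M (\<phi> ` D)) \<phi>) \<and>
     topspace M = (\<Union>(D, \<phi>) \<in> A. \<phi> ` D) \<and>
     (\<forall>(D, \<phi>) \<in> A. \<forall>(E, \<psi>) \<in> A.
        smooth_on {y \<in> E. \<psi> y \<in> \<phi> ` D} (inv_into D \<phi> \<circ> \<psi>))"

definition immersed_surface :: "'a topology \<Rightarrow> 'a chart set \<Rightarrow> ('a \<Rightarrow> complex^2) \<Rightarrow> bool" where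
  "immersed_surface M A f \<longleftrightarrow>
     smooth_surface M A \<and>
     (\<forall>(D, \<phi>) \<in> A. smooth_on D (f \<circ> \<phi>) \<and>
        (\<forall>x\<in>D. inj (frechet_derivative (f \<circ> \<phi>) (at x))))"

definition nondegenerate_surface ::
  "'a topology \<Rightarrow> 'a chart set \<Rightarrow> ('a \<Rightarrow> complex^2) \<Rightarrow> bool" where
  "nondegenerate_surface M A f \<longleftrightarrow>
     immersed_surface M A f \<and>
     (\<forall>(D, \<phi>) \<in> A. \<forall>x\<in>D. \<forall>v. v \<noteq> 0 \<longrightarrow>
        (\<exists>w. metric2 (frechet_derivative (f \<circ> \<phi>) (at x) v)
                      (frechet_derivative (f \<circ> \<phi>) (at x) w) \<noteq> 0))"

definition lagrangian_surface ::
  "'a topology \<Rightarrow> 'a chart set \<Rightarrow> ('a \<Rightarrow> complex^2) \<Rightarrow> bool" where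
  "lagrangian_surface M A f \<longleftrightarrow>
     immersed_surface M A f \<and>
     (\<forall>(D, \<phi>) \<in> A. \<forall>x\<in>D. \<forall>v w.
        \<omega>1 (frechet_derivative (f \<circ> \<phi>) (at x) v)
           (frechet_derivative (f \<circ> \<phi>) (at x) w) = 0)"

definition first_fundamental_form :: "(real^2 \<Rightarrow> complex^2) \<Rightarrow> real^2 \<Rightarrow> real^2^2" where
  "first_fundamental_form F x =
     (\<chi> i j. metric2 (frechet_derivative F (at x) (axis i 1))
                      (frechet_derivative F (at x) (axis j 1)))"

definition area_density :: "(real^2 \<Rightarrow> complex^2) \<Rightarrow> real^2 \<Rightarrow> real" where
  "area_density F x = sqrt \<bar>det (first_fundamental_form F x)\<bar>"

text \<open>
  \<open>has_area A g K a\<close>: the part \<open>K\<close> of the surface has area \<open>a\<close> with respect to the metric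
  induced by \<open>g\<close>. The set \<open>K\<close> is cut into finitely many disjoint pieces \<open>\<phi> ` S\<close>, each lying in
  the range of one chart \<open>(D, \<phi>)\<close>, and the integrals of the area density over the pieces are
  added up. By the change of variables formula the result does not depend on the decomposition.
\<close>

definition has_area ::
  "'a chart set \<Rightarrow> ('a \<Rightarrow> complex^2) \<Rightarrow> 'a set \<Rightarrow> real \<Rightarrow> bool" where
  "has_area A g K a \<longleftrightarrow>
     (\<exists>Q :: ('a chart \<times> (real^2) set) set.
        finite Q \<and>
        (\<forall>((D, \<phi>), S) \<in> Q. (D, \<phi>) \<in> A \<and> S \<in> sets borel \<and> S \<subseteq> D \<and>
           set_integrable lborel S (area_density (g \<circ> \<phi>))) \<and>
        pairwise (\<lambda>((D, \<phi>), S) ((E, \<psi>), T). disjnt (\<phi> ` S) (\<psi> ` T)) Q \<and>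
        K = (\<Union>((D, \<phi>), S) \<in> Q. \<phi> ` S) \<and>
        a = (\<Sum>((D, \<phi>), S) \<in> Q. set_lebesgue_integral lborel S (area_density (g \<circ> \<phi>))))"

definition compactly_supported_variation ::
  "'a topology \<Rightarrow> 'a chart set \<Rightarrow> ('a \<Rightarrow> complex^2) \<Rightarrow> 'a set \<Rightarrow> real
     \<Rightarrow> (real \<Rightarrow> 'a \<Rightarrow> complex^2) \<Rightarrow> bool" where
  "compactly_supported_variation M A f K \<epsilon> F \<longleftrightarrow>
     0 < \<epsilon> \<and> compactin M K \<and>
     (\<forall>(D, \<phi>) \<in> A. smooth_on ({-\<epsilon><..<\<epsilon>} \<times> D) (\<lambda>(t, x). F t (\<phi> x))) \<and>
     (\<forall>p \<in> topspace M. F 0 p = f p) \<and>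
     (\<forall>t \<in> {-\<epsilon><..<\<epsilon>}. \<forall>p \<in> topspace M - K. F t p = f p)"

definition minimal_surface ::
  "'a topology \<Rightarrow> 'a chart set \<Rightarrow> ('a \<Rightarrow> complex^2) \<Rightarrow> bool" where
  "minimal_surface M A f \<longleftrightarrow>
     nondegenerate_surface M A f \<and>
     (\<forall>K \<epsilon> F a.
        compactly_supported_variation M A f K \<epsilon> F \<and>
        (\<forall>t \<in> {-\<epsilon><..<\<epsilon>}. has_area A (F t) K (a t)) \<longrightarrow>
        (a has_real_derivative 0) (at 0))"

definition regular_curve :: "(complex^2) set \<Rightarrow> bool" where
  "regular_curve C \<longleftrightarrow>
     (\<exists>(I :: real set) \<gamma>. open I \<and> is_interval I \<and> I \<noteq> {} \<and> smooth_on I \<gamma> \<and>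
        (\<forall>s\<in>I. vector_derivative \<gamma> (at s) \<noteq> 0) \<and> C = \<gamma> ` I)"

definition curve_product :: "(complex^2) set \<Rightarrow> (complex^2) set \<Rightarrow> (complex^2) set" where
  "curve_product C1 C2 = {x + J y | x y. x \<in> C1 \<and> y \<in> C2}"

text \<open>
  Equality with a product is a local statement about the surface: an open piece of a product,
  such as a disc in a plane, need not itself be a product of two curves. Only the plane \<open>P\<close> can
  be chosen uniformly.
\<close>

definition product_of_curves_at ::
  "'a topology \<Rightarrow> ('a \<Rightarrow> complex^2) \<Rightarrow> (complex^2) set \<Rightarrow> 'a \<Rightarrow> bool" where
  "product_of_curves_at M f P p \<longleftrightarrow>
     (\<exists>U \<gamma>1 \<gamma>2. openin M U \<and> p \<in> U \<and>
        regular_curve \<gamma>1 \<and> \<gamma>1 \<subseteq> P \<and> regular_curve \<gamma>2 \<and> \<gamma>2 \<subseteq> P \<and>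
        homeomorphic_map (subtopology M U) (top_of_set (curve_product \<gamma>1 \<gamma>2)) f)"

end

theory Submission
  imports Defs "HOL-Computational_Algebra.Polynomial"
begin

text \<open>
  Let \<open>\<Omega> = dz1 \<and> dz2\<close>. On a Lagrangian tangent plane the Gram determinant is \<open>- |\<Omega>|^2\<close>, and under a
  variation \<open>f + t h V\<close> (\<open>h\<close> a bump function in a chart, \<open>V\<close> a constant vector) it becomes
  \<open>- |\<Omega>_t|^2 + O(t^2)\<close>, because \<open>\<omega>1\<close> enters only through its square. Hence the first variation of
  area is the integral of \<open>Re (cnj u * \<Omega>')\<close> with \<open>u = \<Omega> / |\<Omega>|\<close>, and its vanishing for all \<open>h\<close>
  and \<open>V\<close> forces \<open>du = 0\<close>: the Lagrangian angle is locally constant, and up to sign \<open>u\<close> is a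
  constant \<open>c\<close> on each connected component.

  Take the null plane \<open>P = {z2 = c cnj z1}\<close>, so that \<open>J P = {z2 = - c cnj z1}\<close>. For the components
  \<open>X\<close> and \<open>Y\<close> of \<open>f\<close> along \<open>P\<close> and \<open>J P\<close>, the area forms \<open>Im (dX cnj dX)\<close> and \<open>Im (dY cnj dY)\<close>
  are combinations of \<open>\<omega>1\<close> and \<open>Im (cnj c \<Omega>)\<close>, which both vanish. So \<open>X\<close> and \<open>Y\<close> have
  rank one, with transversal kernels since \<open>f\<close> is an immersion, and in suitable local coordinates
  \<open>X\<close> depends on the first one only and \<open>Y\<close> on the second one only.
\<close>

section \<open>Calculus of smooth functions\<close>

lemma Ck_on_cong:
  assumes "open S" "\<And>x. x \<in> S \<Longrightarrow> f x = g x"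
  shows "Ck_on k S f \<longleftrightarrow> Ck_on k S g"
  using assms(2)
proof (induction k arbitrary: f g)
  case 0
  then show ?case by (simp cong: continuous_on_cong)
next
  case (Suc k)
  have 1: "f differentiable at x \<longleftrightarrow> g differentiable at x" if "x \<in> S" for x
    using that assms(1) Suc.prems has_derivative_transform_within_open[of f _ x UNIV S g]
      has_derivative_transform_within_open[of g _ x UNIV S f] unfolding differentiable_def by auto
  have dd: "f differentiable_on S \<longleftrightarrow> g differentiable_on S"
    using 1 assms(1) by (simp add: differentiable_on_eq_differentiable_at)
  have "Ck_on k S (\<lambda>x. frechet_derivative f (at x) v) = Ck_on k S (\<lambda>x. frechet_derivative g (at x) v)"
    if "f differentiable_on S" for v
  proof (rule Suc.IH)
    fix x assume "x \<in> S"
    with that have "f differentiable at x"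
      using assms(1) differentiable_on_eq_differentiable_at by blast
    then show "frechet_derivative f (at x) v = frechet_derivative g (at x) v"
      using frechet_derivative_transform_within_open[of f x S g] \<open>x \<in> S\<close> assms(1) Suc.prems by auto
  qed
  then show ?case using dd by auto
qed

text \<open>The \<open>has_derivative\<close> rules supply an explicit candidate \<open>f'\<close>;
  most closure properties below then become inductions on the order, since \<open>f'\<close> is
  built from functions already treated.\<close>

lemma Ck_on_SucI:
  assumes "open S" "\<And>x. x \<in> S \<Longrightarrow> (f has_derivative f' x) (at x)"
    and "\<And>v. Ck_on k S (\<lambda>x. f' x v)"
  shows "Ck_on (Suc k) S f"
proof -
  have "f differentiable_on S"
    using assms(1,2) differentiableI differentiable_on_eq_differentiable_at by blast
  moreover have "Ck_on k S (\<lambda>x. frechet_derivative f (at x) v)" for v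
    using assms(3)[of v] Ck_on_cong[OF assms(1), of "\<lambda>x. f' x v" "\<lambda>x. frechet_derivative f (at x) v"]
      frechet_derivative_at[OF assms(2)] by simp
  ultimately show ?thesis by simp
qed

lemma Ck_on_has_derivative:
  assumes "open S" "Ck_on (Suc k) S f" "x \<in> S"
  shows "(f has_derivative frechet_derivative f (at x)) (at x)"
  using assms differentiable_on_eq_differentiable_at[OF assms(1)] frechet_derivative_works by auto

lemma Ck_on_pred:
  assumes "open S" shows "Ck_on (Suc k) S f \<Longrightarrow> Ck_on k S f"
proof (induction k arbitrary: f)
  case 0
  then show ?case by (simp add: differentiable_imp_continuous_on)
next
  case (Suc k)
  then show ?case by simp
qed

lemma Ck_on_antimono:
  assumes "open S" "Ck_on n S f" "m \<le> n" shows "Ck_on m S f"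
  using assms(3,2) by (induction rule: inc_induct) (auto intro: Ck_on_pred[OF assms(1)] simp del: Ck_on.simps)

lemma Ck_on_continuous_on: "open S \<Longrightarrow> Ck_on k S f \<Longrightarrow> continuous_on S f"
  using Ck_on_antimono[of S k f 0] by simp

lemma Ck_on_subset: "Ck_on k S f \<Longrightarrow> T \<subseteq> S \<Longrightarrow> Ck_on k T f"
  by (induction k arbitrary: f) (auto intro: continuous_on_subset differentiable_on_subset)

text \<open>Differentiability at a point of an open set is local, so smoothness can be checked on an
  open cover. This handles functions extended by zero.\<close>

lemma Ck_on_Un:
  assumes "open S" "open T" shows "Ck_on k S f \<Longrightarrow> Ck_on k T f \<Longrightarrow> Ck_on k (S \<union> T) f"
proof (induction k arbitrary: f)
  case 0
  then show ?case using assms by (simp add: continuous_on_open_Un)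
next
  case (Suc k)
  then show ?case
    using assms by (auto simp: differentiable_on_eq_differentiable_at open_Un)
qed

lemma Ck_on_const: "open S \<Longrightarrow> Ck_on k S (\<lambda>x. c)"
proof (induction k arbitrary: c)
  case (Suc k)
  show ?case by (rule Ck_on_SucI[OF _ has_derivative_const]) (use Suc in auto)
qed simp

lemma Ck_on_linear:
  assumes "open S" "bounded_linear L" shows "Ck_on k S L"
proof (cases k)
  case 0
  then show ?thesis using assms(2) by (simp add: linear_continuous_on)
next
  case (Suc n)
  show ?thesis unfolding Suc
    by (rule Ck_on_SucI[OF assms(1) bounded_linear.has_derivative[OF assms(2) has_derivative_ident]])
      (rule Ck_on_const[OF assms(1)])
qed

lemma Ck_on_linear_compose:
  assumes "open S" "bounded_linear L" shows "Ck_on k S f \<Longrightarrow> Ck_on k S (\<lambda>x. L (f x))"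
proof (induction k arbitrary: f)
  case 0
  then show ?case
    using assms(2) by (simp add: linear_continuous_on_compose bounded_linear.linear)
next
  case (Suc k)
  show ?case
    by (rule Ck_on_SucI[OF assms(1) bounded_linear.has_derivative[OF assms(2) Ck_on_has_derivative[OF assms(1) Suc.prems]]])
      (use Suc in auto)
qed

lemma Ck_on_add:
  assumes "open S" shows "Ck_on k S f \<Longrightarrow> Ck_on k S g \<Longrightarrow> Ck_on k S (\<lambda>x. f x + g x)"
proof (induction k arbitrary: f g)
  case 0
  then show ?case by (simp add: continuous_on_add)
next
  case (Suc k)
  show ?case
    by (rule Ck_on_SucI[OF assms has_derivative_add[OF Ck_on_has_derivative[OF assms Suc.prems(1)]
              Ck_on_has_derivative[OF assms Suc.prems(2)]]])
      (use Suc in auto)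
qed

lemma Ck_on_bilinear:
  assumes "open S" "bounded_bilinear b"
  shows "Ck_on k S f \<Longrightarrow> Ck_on k S g \<Longrightarrow> Ck_on k S (\<lambda>x. b (f x) (g x))"
proof (induction k arbitrary: f g)
  case 0
  then show ?case using bounded_bilinear.continuous_on[OF assms(2)] by simp
next
  case (Suc k)
  have k: "Ck_on k S f" "Ck_on k S g" using Suc.prems Ck_on_pred[OF assms(1)] by blast+
  show ?case
    by (rule Ck_on_SucI[OF assms(1) bounded_bilinear.FDERIV[OF assms(2) Ck_on_has_derivative[OF assms(1) Suc.prems(1)]
              Ck_on_has_derivative[OF assms(1) Suc.prems(2)]]])
      (use Suc k assms(1) in \<open>auto intro!: Ck_on_add\<close>)
qed

lemma Ck_on_sum:
  assumes "open S" "\<And>i. i \<in> I \<Longrightarrow> Ck_on k S (f i)"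
  shows "Ck_on k S (\<lambda>x. \<Sum>i\<in>I. f i x)"
  using assms(2)
  by (induction I rule: infinite_finite_induct) (auto intro: Ck_on_const Ck_on_add assms(1))

text \<open>The chain rule evaluates the derivative of \<open>f\<close> in a direction that varies
  with the point. Expanding this direction in the basis leaves fixed directional derivatives of
  \<open>f\<close> composed with \<open>g\<close>, which is why the induction generalises over
  \<open>f\<close>.\<close>

lemma Ck_on_compose:
  fixes f :: "'b::euclidean_space \<Rightarrow> 'c::euclidean_space" and g :: "'a::euclidean_space \<Rightarrow> 'b"
  assumes "open S" "open T" "g ` S \<subseteq> T"
  shows "Ck_on k T f \<Longrightarrow> Ck_on k S g \<Longrightarrow> Ck_on k S (\<lambda>x. f (g x))"
proof (induction k arbitrary: f)
  case 0
  then show ?case using continuous_on_compose2[of T f S g] assms(3) by simp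
next
  case (Suc k)
  let ?D = "\<lambda>x v. frechet_derivative f (at (g x)) (frechet_derivative g (at x) v)"
  have 1: "((\<lambda>x. f (g x)) has_derivative ?D x) (at x)" if "x \<in> S" for x
    using has_derivative_compose[OF Ck_on_has_derivative[OF assms(1) Suc.prems(2) that]]
      Ck_on_has_derivative[OF assms(2) Suc.prems(1), of "g x"] that assms(3) by blast
  have g: "Ck_on k S g" using Suc.prems Ck_on_pred[OF assms(1)] by blast
  have "Ck_on k S (\<lambda>x. ?D x v)" for v
  proof -
    have lin: "linear (frechet_derivative f (at (g x)))" if "x \<in> S" for x
      using Ck_on_has_derivative[OF assms(2) Suc.prems(1), of "g x"] that assms(3)
        has_derivative_linear by blast
    have "?D x v = (\<Sum>b\<in>Basis. (frechet_derivative g (at x) v \<bullet> b) *\<^sub>R frechet_derivative f (at (g x)) b)"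
      if "x \<in> S" for x
      by (subst euclidean_representation[symmetric, of "frechet_derivative g (at x) v"])
        (simp add: linear_sum[OF lin[OF that]] linear_scale[OF lin[OF that]])
    moreover have "Ck_on k S (\<lambda>x. \<Sum>b\<in>Basis. (frechet_derivative g (at x) v \<bullet> b) *\<^sub>R frechet_derivative f (at (g x)) b)"
      by (intro Ck_on_sum Ck_on_bilinear[OF _ bounded_bilinear_scaleR] assms(1)
          Ck_on_linear_compose[OF _ bounded_linear_inner_left] Suc.IH g) (use Suc.prems in auto)
    ultimately show ?thesis
      by (subst Ck_on_cong[OF assms(1)])
  qed
  with 1 show ?case by (rule Ck_on_SucI[OF assms(1)])
qed

text \<open>For a family closed under differentiation, with \<open>n\<close> sending an index to
  that of the derivative, one induction on the order treats all members at once.\<close>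

lemma Ck_on_family:
  fixes D :: "'i \<Rightarrow> real \<Rightarrow> real" and n :: "'i \<Rightarrow> 'i"
  assumes "open S" "\<And>i x. x \<in> S \<Longrightarrow> (D i has_real_derivative D (n i) x) (at x)"
  shows "Ck_on k S (D i)"
proof (induction k arbitrary: i)
  case 0
  then show ?case
    using assms by (auto simp: continuous_on_eq_continuous_at intro!: DERIV_isCont)
next
  case (Suc k)
  show ?case
    by (rule Ck_on_SucI[OF assms(1) assms(2)[unfolded has_field_derivative_def]])
      (auto intro!: Ck_on_bilinear[OF assms(1) bounded_bilinear_mult] Suc Ck_on_const assms(1))
qed

lemma Ck_on_powr: "Ck_on k {0<..} (\<lambda>x::real. x powr a)"
proof -
  \<comment> \<open>The pair (c, b) indexes the monomial c x^b, whose derivative has index (c b, b -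
    1).\<close>
  have "Ck_on k {0<..} ((\<lambda>(c, b) x::real. c * x powr b) (1, a))"
    by (rule Ck_on_family[where n = "\<lambda>(c, b). (c * b, b - 1)"])
      (auto split: prod.splits intro!: derivative_eq_intros)
  then show ?thesis by simp
qed

lemma smooth_on_frechet_derivative:
  assumes "open S" "smooth_on S f"
  shows "smooth_on S (\<lambda>x. frechet_derivative f (at x) v)"
  using assms unfolding smooth_on_def by (metis Ck_on.simps(2))

section \<open>Bump functions\<close>

text \<open>The classical flat function exp (-1/x), multiplied by a polynomial in 1/x so that the
  family is closed under differentiation.\<close>

definition flat :: "real poly \<Rightarrow> real \<Rightarrow> real" where
  "flat p x = (if x > 0 then poly p (inverse x) * exp (- inverse x) else 0)"

lemma poly_mult_exp_uminus_tendsto_0: "((\<lambda>y. poly p y * exp (- y :: real)) \<longlongrightarrow> 0) at_top"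
proof -
  have "((\<lambda>y. \<Sum>i\<le>degree p. coeff p i * (y ^ i / exp y)) \<longlongrightarrow> (\<Sum>i\<le>degree p. coeff p i * 0)) at_top"
    by (intro tendsto_intros tendsto_power_div_exp_0)
  then show ?thesis
    by (simp add: poly_altdef sum_distrib_right exp_minus divide_inverse mult.assoc)
qed

text \<open>With y = 1/x, hence dy/dx = - y^2, the derivative of p(y) exp (-y) is y^2 (p - p')(y)
  exp (-y).\<close>

definition flat_deriv :: "real poly \<Rightarrow> real poly" where
  "flat_deriv p = [:0, 0, 1:] * (p - pderiv p)"

lemma flat_has_real_derivative:
  "(flat p has_real_derivative flat (flat_deriv p) x) (at x)"
proof -
  consider "x > 0" | "x < 0" | "x = 0" by linarith
  then show ?thesis
  proof cases
    case 1
    have "((\<lambda>x. poly p (inverse x) * exp (- inverse x)) has_real_derivative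
        flat (flat_deriv p) x) (at x)"
      using 1 by (auto simp: flat_def flat_deriv_def power2_eq_square algebra_simps
          intro!: derivative_eq_intros DERIV_chain2[OF poly_DERIV])
    then show ?thesis
      by (rule has_field_derivative_transform_within_open[where S = "{0<..}"]) (use 1 in \<open>auto simp: flat_def\<close>)
  next
    case 2
    have "((\<lambda>x. 0) has_real_derivative flat (flat_deriv p) x) (at x)"
      using 2 by (simp add: flat_def)
    then show ?thesis
      by (rule has_field_derivative_transform_within_open[where S = "{..<0}"]) (use 2 in \<open>auto simp: flat_def\<close>)
  next
    case 3
    \<comment> \<open>From the right the difference quotient at 0 is q(1/h) exp (-1/h) with q(y) = y
      p(y), that is \<open>pCons 0 p\<close>; the exponential beats every polynomial.\<close>
    have "((\<lambda>h. flat p h / h) \<longlongrightarrow> 0) (at_right 0)"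
    proof (rule Lim_transform_eventually)
      show "((\<lambda>h. poly (pCons 0 p) (inverse h) * exp (- inverse h)) \<longlongrightarrow> 0) (at_right (0::real))"
        by (rule filterlim_compose[OF poly_mult_exp_uminus_tendsto_0 filterlim_inverse_at_top_right])
      show "\<forall>\<^sub>F h in at_right 0. poly (pCons 0 p) (inverse h) * exp (- inverse h) = flat p h / h"
        unfolding eventually_at_right_field by (auto intro!: exI[of _ 1] simp: flat_def field_simps)
    qed
    moreover have "((\<lambda>h. flat p h / h) \<longlongrightarrow> 0) (at_left 0)"
      by (rule Lim_transform_eventually[OF tendsto_const])
        (auto simp: eventually_at_left_field flat_def intro!: exI[of _ "-1"])
    ultimately show ?thesis
      using 3 by (simp add: DERIV_def flat_def[of _ 0] filterlim_split_at)
  qed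
qed

lemma Ck_on_flat: "open S \<Longrightarrow> Ck_on k S (flat p)"
  by (rule Ck_on_family[where n = flat_deriv])
    (simp_all only: flat_has_real_derivative)

text \<open>For positive \<open>r\<close> it vanishes off the open ball of radius \<open>r\<close>
  about \<open>c\<close>, and for \<open>p = 1\<close> it is positive inside. Keeping
  \<open>p\<close> as a parameter lets derivatives be expressed by bumps with other
  polynomials.\<close>

definition bump :: "'a::euclidean_space \<Rightarrow> real \<Rightarrow> real poly \<Rightarrow> 'a \<Rightarrow> real" where
  "bump c r p x = flat p (r\<^sup>2 - (x - c) \<bullet> (x - c))"

lemma Ck_on_bump:
  assumes "open S" shows "Ck_on k S (bump c r p)"
proof -
  have "Ck_on k S (\<lambda>x. x - c)"
    using Ck_on_add[OF assms Ck_on_linear[OF assms bounded_linear_ident] Ck_on_const[OF assms], of k "- c"]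
    by simp
  from Ck_on_bilinear[OF assms bounded_bilinear_inner this this]
  have "Ck_on k S (\<lambda>x. r\<^sup>2 + - ((x - c) \<bullet> (x - c)))"
    by (intro Ck_on_add Ck_on_const assms
        Ck_on_linear_compose[OF _ bounded_linear_minus[OF bounded_linear_ident], unfolded o_def])
  from Ck_on_compose[OF assms open_UNIV _ Ck_on_flat[OF open_UNIV] this]
  show ?thesis unfolding bump_def[abs_def] by simp
qed

definition dbump :: "'a::euclidean_space \<Rightarrow> real \<Rightarrow> real poly \<Rightarrow> 'a \<Rightarrow> 'a \<Rightarrow> real" where
  "dbump c r p x v = - 2 * bump c r (flat_deriv p) x * ((x - c) \<bullet> v)"

lemma bump_has_derivative: "(bump c r p has_derivative dbump c r p x) (at x)"
proof -
  have "((\<lambda>x. r\<^sup>2 - (x - c) \<bullet> (x - c)) has_derivative (\<lambda>v. - 2 * ((x - c) \<bullet> v))) (at x)"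
    by (auto intro!: derivative_eq_intros simp: inner_commute)
  from has_derivative_compose[OF this flat_has_real_derivative[unfolded has_field_derivative_def]]
  show ?thesis unfolding bump_def[abs_def] dbump_def[abs_def] by (simp add: algebra_simps)
qed

text \<open>Once \<open>dbump\<close> is unfolded, the formula is symmetric in \<open>u\<close> and
  \<open>v\<close>; the symmetry of second derivatives in general is derived from this.\<close>

lemma dbump_has_derivative:
  "((\<lambda>x. dbump c r p x v) has_derivative
     (\<lambda>u. - 2 * (dbump c r (flat_deriv p) x u * ((x - c) \<bullet> v) + bump c r (flat_deriv p) x * (u \<bullet> v)))) (at x)"
  unfolding dbump_def[of _ _ p]
  by (auto intro!: derivative_eq_intros bump_has_derivative simp: algebra_simps)

lemma continuous_on_bump: "continuous_on S (bump c r p)"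
  using Ck_on_bump[of UNIV 0 c r p] continuous_on_subset by auto

lemma continuous_on_dbump: "continuous_on S (\<lambda>x. dbump c r p x v)"
  unfolding dbump_def by (intro continuous_intros continuous_on_bump)

lemma bump_eq_0:
  assumes "0 \<le> r" "r \<le> dist c x" shows "bump c r p x = 0"
proof -
  have "r\<^sup>2 \<le> (norm (x - c))\<^sup>2"
    using assms by (intro power_mono) (simp_all add: dist_norm norm_minus_commute)
  then show ?thesis by (simp add: bump_def flat_def dot_square_norm)
qed

lemma bump_pos: "dist c x < r \<Longrightarrow> bump c r 1 x > 0"
  unfolding bump_def flat_def dot_square_norm dist_norm
  by (auto simp: norm_minus_commute power_strict_mono)

lemma bump_nonneg: "bump c r 1 x \<ge> 0"
  by (simp add: bump_def flat_def)

section \<open>Integration by parts against bump functions\<close>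

text \<open>The integral of \<open>x \<mapsto> k (x + t v)\<close> does not depend on \<open>t\<close>; differentiate at \<open>t = 0\<close>.\<close>

lemma integral_derivative_compact_support:
  fixes k :: "'a::euclidean_space \<Rightarrow> real"
  assumes k: "\<And>x. (k has_derivative k' x) (at x)" and cont: "continuous_on UNIV (\<lambda>x. k' x v)"
    and supp: "\<And>x. r \<le> dist c x \<Longrightarrow> k x = 0" and r: "0 < r" and box: "cball c (2 * r) \<subseteq> cbox a b"
  shows "integral (cbox a b) (\<lambda>x. k' x v) = 0"
proof -
  \<comment> \<open>For |t| < d the shift t v has norm at most r, so the shifted box still contains
    the ball supporting \<open>k\<close>. Adding 1 keeps the denominator positive when v =
    0.\<close>
  define d where "d = r / (norm v + 1)"
  have d: "d > 0" using r by (simp add: d_def add_nonneg_pos)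
  have contk: "continuous_on UNIV k"
    using has_derivative_continuous[OF k] by (simp add: continuous_on_eq_continuous_at)
  have const: "integral (cbox a b) (\<lambda>x. k (x + t *\<^sub>R v)) = integral UNIV k" if t: "t \<in> {-d<..<d}" for t
  proof -
    have "norm (t *\<^sub>R v) \<le> r"
    proof -
      have "\<bar>t\<bar> * norm v \<le> d * (norm v + 1)" using t by (intro mult_mono) auto
      then show ?thesis by (simp add: d_def add_nonneg_eq_0_iff)
    qed
    then have "cball c r \<subseteq> cbox (a + t *\<^sub>R v) (b + t *\<^sub>R v)"
    proof (intro subsetI)
      fix x assume "norm (t *\<^sub>R v) \<le> r" "x \<in> cball c r"
      then have "dist c (x - t *\<^sub>R v) \<le> 2 * r"
        using norm_triangle_ineq[of "c - x" "t *\<^sub>R v"] by (simp add: dist_norm algebra_simps)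
      then have "x - t *\<^sub>R v \<in> cbox a b" using box by auto
      then show "x \<in> cbox (a + t *\<^sub>R v) (b + t *\<^sub>R v)"
        by (auto simp: mem_box algebra_simps)
    qed
    then have sub: "k x = 0" if "x \<notin> cbox (a + t *\<^sub>R v) (b + t *\<^sub>R v)" for x
      using that supp[of x] by force
    have "integral (cbox a b) (\<lambda>x. k (x + t *\<^sub>R v)) = integral (cbox (a + t *\<^sub>R v) (b + t *\<^sub>R v)) k"
      using integral_shift_cbox_plus[of a b k "t *\<^sub>R v"] by (simp add: o_def add.commute)
    also have "\<dots> = integral UNIV k"
      by (subst integral_restrict_UNIV[symmetric]) (rule integral_cong, use sub in auto)
    finally show ?thesis .
  qed
  have "((\<lambda>t. integral (cbox a b) (\<lambda>x. k (x + t *\<^sub>R v))) has_vector_derivative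
      integral (cbox a b) (\<lambda>x. k' (x + 0 *\<^sub>R v) v)) (at 0 within {-d<..<d})"
  proof (rule leibniz_rule_vector_derivative[where fx = "\<lambda>t x. k' (x + t *\<^sub>R v) v"])
    show "((\<lambda>t. k (x + t *\<^sub>R v)) has_vector_derivative k' (x + t *\<^sub>R v) v) (at t within {-d<..<d})" for t x
    proof -
      have "((\<lambda>t. k (x + t *\<^sub>R v)) has_derivative (\<lambda>s. k' (x + t *\<^sub>R v) (s *\<^sub>R v))) (at t within {-d<..<d})"
        by (rule has_derivative_compose[OF _ k]) (auto intro!: derivative_eq_intros)
      then show ?thesis
        by (simp add: has_vector_derivative_def linear_cmul[OF has_derivative_linear[OF k]])
    qed
    show "(\<lambda>x. k (x + t *\<^sub>R v)) integrable_on cbox a b" for t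
      by (intro integrable_continuous continuous_on_compose2[OF contk] continuous_intros) auto
    show "continuous_on ({-d<..<d} \<times> cbox a b) (\<lambda>(t, x). k' (x + t *\<^sub>R v) v)"
      unfolding split_beta
      by (intro continuous_on_compose2[OF cont] continuous_intros) auto
  qed (use d in auto)
  moreover have "((\<lambda>t. integral (cbox a b) (\<lambda>x. k (x + t *\<^sub>R v))) has_vector_derivative 0) (at 0 within {-d<..<d})"
    by (rule has_vector_derivative_transform[OF _ _ has_vector_derivative_const]) (use const d in auto)
  ultimately show ?thesis
    using vector_derivative_unique_at[of _ _ 0] d by (simp add: at_within_open[of 0 "{-d<..<d}"])
qed

text \<open>The product h G, extended by zero outside \<open>D\<close>, is differentiable everywhere
  and supported in the ball of radius \<open>r\<close>. Its directional derivative therefore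
  integrates to zero, and the product rule splits this integral in two.\<close>

lemma integral_by_parts_bump:
  fixes G :: "'a::euclidean_space \<Rightarrow> real"
  assumes D: "open D" and G: "\<And>x. x \<in> D \<Longrightarrow> (G has_derivative G' x) (at x)"
    and G': "continuous_on D (\<lambda>x. G' x v)"
    and r: "0 < r" and box: "cball c (2 * r) \<subseteq> cbox a b" "cbox a b \<subseteq> D"
    and h: "\<And>x. (h has_derivative h' x) (at x)" and h': "continuous_on UNIV (\<lambda>x. h' x v)"
    and supp: "\<And>x. r \<le> dist c x \<Longrightarrow> h x = 0"
  shows "integral (cbox a b) (\<lambda>x. h' x v * G x) = - integral (cbox a b) (\<lambda>x. h x * G' x v)"
proof -
  define k where "k x = (if x \<in> D then h x * G x else 0)" for x
  define k' where "k' x v = (if x \<in> D then h x * G' x v + h' x v * G x else 0)" for x v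
  have conth: "continuous_on UNIV h"
    using has_derivative_continuous[OF h] by (simp add: continuous_on_eq_continuous_at)
  have contG: "continuous_on D G"
    using has_derivative_continuous[OF G] D by (simp add: continuous_on_eq_continuous_at)
  have cD: "cball c r \<subseteq> D" using box r by force
  have h'0: "h' x = (\<lambda>_. 0)" if "x \<notin> cball c r" for x
  proof -
    have "((\<lambda>x. 0) has_derivative h' x) (at x)"
      by (rule has_derivative_transform_within_open[of h "h' x" x UNIV "- cball c r" "\<lambda>x. 0", OF h]) (use that supp in auto)
    then show ?thesis by (metis has_derivative_const has_derivative_unique)
  qed
  have k0: "k x = 0" "k' x v = 0" if "x \<notin> cball c r" for x v
    using that supp[of x] h'0[of x] by (auto simp: k_def k'_def)
  \<comment> \<open>Two open sets cover the space: on \<open>D\<close> the product rule applies, and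
    off the closed ball everything vanishes.\<close>
  have cover: "UNIV = D \<union> - cball c r" using cD by auto
  have "(k has_derivative k' x) (at x)" for x
  proof (cases "x \<in> D")
    case True
    show ?thesis
    proof (rule has_derivative_transform_within_open[OF _ D True])
      show "((\<lambda>x. h x * G x) has_derivative k' x) (at x)"
        using has_derivative_mult[OF h G[OF True]] True by (simp add: k'_def[abs_def])
    qed (simp add: k_def)
  next
    case False
    then have x: "x \<notin> cball c r" using cD by auto
    show ?thesis
    proof (rule has_derivative_transform_within_open[of "\<lambda>x. 0" _ _ _ "- cball c r"])
      show "((\<lambda>x. 0) has_derivative k' x) (at x)"
        using k0(2)[OF x] has_derivative_const by (metis ext)
    qed (use x k0(1) in auto)
  qed
  moreover have "continuous_on UNIV (\<lambda>x. k' x v)"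
    unfolding cover
  proof (rule continuous_on_open_Un[OF D])
    show "continuous_on D (\<lambda>x. k' x v)"
      by (rule continuous_on_eq[of _ "\<lambda>x. h x * G' x v + h' x v * G x"])
        (auto simp: k'_def intro!: continuous_intros contG G' continuous_on_subset[OF conth] continuous_on_subset[OF h'])
    show "continuous_on (- cball c r) (\<lambda>x. k' x v)"
      by (rule continuous_on_eq[of _ "\<lambda>x. 0"]) (use k0 in auto)
  qed auto
  moreover have "k x = 0" if "r \<le> dist c x" for x using that supp by (simp add: k_def)
  ultimately have "integral (cbox a b) (\<lambda>x. k' x v) = 0"
    by (rule integral_derivative_compact_support[OF _ _ _ r box(1)])
  also have "integral (cbox a b) (\<lambda>x. k' x v) = integral (cbox a b) (\<lambda>x. h x * G' x v + h' x v * G x)"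
    using box(2) by (intro integral_cong) (auto simp: k'_def)
  also have "\<dots> = integral (cbox a b) (\<lambda>x. h x * G' x v) + integral (cbox a b) (\<lambda>x. h' x v * G x)"
    using box(2)
    by (intro integral_add integrable_continuous continuous_intros continuous_on_subset[OF conth]
       continuous_on_subset[OF h'] continuous_on_subset[OF contG] continuous_on_subset[OF G']) auto
  finally show ?thesis by linarith
qed

text \<open>The fundamental lemma of the calculus of variations for a divergence along
  \<open>v\<close> and \<open>w\<close>: if it were nonzero at a point, a bump supported where it
  keeps its sign would give a nonzero integral after integration by parts.\<close>

lemma weakly_divergence_free:
  fixes G H :: "'a::euclidean_space \<Rightarrow> real"
  assumes D: "open D" and G: "\<And>x. x \<in> D \<Longrightarrow> (G has_derivative G' x) (at x)"
    and H: "\<And>x. x \<in> D \<Longrightarrow> (H has_derivative H' x) (at x)"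
    and G': "continuous_on D (\<lambda>x. G' x v)" and H': "continuous_on D (\<lambda>x. H' x w)"
    and weak: "\<And>c r a b. 0 < r \<Longrightarrow> cball c (2 * r) \<subseteq> cbox a b \<Longrightarrow> cbox a b \<subseteq> D \<Longrightarrow>
      integral (cbox a b) (\<lambda>x. dbump c r 1 x v * G x + dbump c r 1 x w * H x) = 0"
    and x0: "x0 \<in> D"
  shows "G' x0 v + H' x0 w = 0"
proof (rule ccontr)
  define K where "K x = G' x v + H' x w" for x
  \<comment> \<open>The sign factor treats positive and negative divergence at once.\<close>
  define s where "s = sgn (K x0)"
  assume "G' x0 v + H' x0 w \<noteq> 0"
  then have pos0: "0 < s * K x0"
    using abs_sgn[of "K x0"] by (simp add: s_def K_def mult.commute)
  have contK: "continuous_on D K" unfolding K_def by (intro continuous_intros G' H')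
  have contG: "continuous_on D G"
    using has_derivative_continuous[OF G] D by (simp add: continuous_on_eq_continuous_at)
  have contH: "continuous_on D H"
    using has_derivative_continuous[OF H] D by (simp add: continuous_on_eq_continuous_at)
  define E where "E = D \<inter> (\<lambda>x. s * K x) -` {0<..}"
  have "open E" unfolding E_def
    by (intro continuous_open_preimage continuous_intros contK D)
  moreover have "x0 \<in> E" using pos0 x0 by (simp add: E_def)
  ultimately obtain a b where ab: "cbox a b \<subseteq> E" "x0 \<in> box a b"
    by (rule open_contains_cbox)
  obtain q where q: "q > 0" "cball x0 q \<subseteq> box a b"
    using open_contains_cball[of "box a b"] ab(2) open_box by blast
  \<comment> \<open>Halving leaves room for the ball of radius 2 r that integration by parts asks
    for.\<close>
  define r where "r = q / 2"
  have r: "r > 0" "cball x0 (2 * r) \<subseteq> cbox a b"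
    using q box_subset_cbox[of a b] by (auto simp: r_def)
  have abD: "cbox a b \<subseteq> D" using ab by (auto simp: E_def)
  let ?h = "bump x0 r 1"
  note parts = integral_by_parts_bump[OF D _ _ r abD bump_has_derivative continuous_on_dbump bump_eq_0[OF less_imp_le[OF r(1)]]]
  have cG: "continuous_on (cbox a b) (\<lambda>x. dbump x0 r 1 x v * G x)"
    and cH: "continuous_on (cbox a b) (\<lambda>x. dbump x0 r 1 x w * H x)"
    and cG': "continuous_on (cbox a b) (\<lambda>x. ?h x * G' x v)"
    and cH': "continuous_on (cbox a b) (\<lambda>x. ?h x * H' x w)"
    by (intro continuous_on_mult continuous_on_dbump continuous_on_bump continuous_on_subset[OF contG abD]
        continuous_on_subset[OF contH abD] continuous_on_subset[OF G' abD] continuous_on_subset[OF H' abD])+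
  have "0 = integral (cbox a b) (\<lambda>x. dbump x0 r 1 x v * G x) + integral (cbox a b) (\<lambda>x. dbump x0 r 1 x w * H x)"
    by (subst integral_add[symmetric]) (auto intro!: integrable_continuous cG cH simp: weak[OF r abD])
  also have "\<dots> = - (integral (cbox a b) (\<lambda>x. ?h x * G' x v) + integral (cbox a b) (\<lambda>x. ?h x * H' x w))"
    using parts[OF G G'] parts[OF H H'] by simp
  also have "\<dots> = - integral (cbox a b) (\<lambda>x. ?h x * K x)"
    by (subst integral_add[symmetric])
      (auto intro!: integrable_continuous cG' cH' simp: K_def distrib_left)
  finally have int0: "integral (cbox a b) (\<lambda>x. s * (?h x * K x)) = 0" by simp
  have cK: "continuous_on (cbox a b) (\<lambda>x. s * (?h x * K x))"
    by (intro continuous_intros continuous_on_bump continuous_on_subset[OF contK abD])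
  have int: "((\<lambda>x. s * (?h x * K x)) has_integral 0) (cbox a b)"
    using integrable_integral[OF integrable_continuous[OF cK]] unfolding int0 .
  have nonneg: "s * (?h x * K x) \<ge> 0" if "x \<in> cbox a b" for x
  proof -
    have "0 < s * K x" using that ab(1) by (auto simp: E_def)
    then have "0 \<le> ?h x * (s * K x)" using mult_nonneg_nonneg[OF bump_nonneg less_imp_le] by blast
    then show ?thesis by (simp add: algebra_simps)
  qed
  have ne: "box a b \<noteq> {}" using ab(2) by blast
  have x0ab: "x0 \<in> cbox a b" and sub: "\<And>x. x \<in> box a b \<Longrightarrow> x \<in> cbox a b"
    using ab(2) box_subset_cbox[of a b] by blast+
  have "s * (?h x0 * K x0) = 0"
    by (rule has_integral_0_cbox_imp_0[OF cK nonneg[OF sub] int ne x0ab])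
  with pos0 bump_pos[of x0 x0 r] r show False by auto
qed

text \<open>
  A bump function has symmetric second derivatives by inspection, and integrating by parts twice
  transfers this to \<open>f\<close>.
\<close>

lemma frechet_derivative_symmetric:
  fixes f :: "'a::euclidean_space \<Rightarrow> real"
  assumes D: "open D" and f: "Ck_on 2 D f" and x: "x \<in> D"
  shows "frechet_derivative (\<lambda>x. frechet_derivative f (at x) u) (at x) v =
    frechet_derivative (\<lambda>x. frechet_derivative f (at x) v) (at x) u"
proof -
  let ?f = "\<lambda>u x. frechet_derivative f (at x) u"
  have f1: "Ck_on (Suc 0) D (?f u)" for u using f by (simp add: numeral_2_eq_2)
  have f0: "Ck_on (Suc 0) D f" using f Ck_on_pred[OF D, of 1 f] by (simp add: numeral_2_eq_2)
  have fd: "(?f u has_derivative frechet_derivative (?f u) (at x)) (at x)" if "x \<in> D" for x u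
    by (rule Ck_on_has_derivative[OF D f1 that])
  have cont1: "continuous_on D (?f u)" for u using Ck_on_continuous_on[OF D f1] .
  have cont2: "continuous_on D (\<lambda>x. frechet_derivative (?f u) (at x) v)" for u v
    using f1[of u] by simp
  \<comment> \<open>The commutator of the two derivatives is the divergence of the field with
    components \<open>?f u\<close> and \<open>- ?f v\<close>, so the weak criterion applies.\<close>
  have "frechet_derivative (?f u) (at x) v + - frechet_derivative (?f v) (at x) u = 0"
  proof (rule weakly_divergence_free[where G = "?f u" and H = "\<lambda>x. - ?f v x" and v = v and w = u
      and H' = "\<lambda>x u. - frechet_derivative (?f v) (at x) u", OF D fd has_derivative_minus[OF fd] cont2 _ _ x])
    show "continuous_on D (\<lambda>x. - frechet_derivative (?f v) (at x) u)"
      by (intro continuous_intros cont2)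
    fix c :: 'a and r :: real and a b assume r: "0 < r" "cball c (2 * r) \<subseteq> cbox a b" and ab: "cbox a b \<subseteq> D"
    \<comment> \<open>The derivative of \<open>f\<close> in direction \<open>u\<close> moves onto
      the bump, leaving \<open>f\<close> against an explicit second derivative that is symmetric in
      both directions.\<close>
    have parts: "integral (cbox a b) (\<lambda>x. dbump c r 1 x v * ?f u x) =
      - integral (cbox a b) (\<lambda>x. - 2 * (dbump c r (flat_deriv 1) x u * ((x - c) \<bullet> v) + bump c r (flat_deriv 1) x * (u \<bullet> v)) * f x)" for u v
    proof -
      have "dbump c r 1 x v = 0" if "r \<le> dist c x" for x
        using that r by (simp add: dbump_def bump_eq_0)
      from integral_by_parts_bump[OF D Ck_on_has_derivative[OF D f0] cont1 r ab dbump_has_derivative _ this]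
      show ?thesis by (simp add: continuous_on_bump continuous_on_dbump continuous_intros)
    qed
    have "integral (cbox a b) (\<lambda>x. dbump c r 1 x v * ?f u x) = integral (cbox a b) (\<lambda>x. dbump c r 1 x u * ?f v x)"
      unfolding parts[of u v] parts[of v u] by (simp only: dbump_def inner_commute[of u v] mult_ac)
    moreover have "(\<lambda>x. dbump c r 1 x v * ?f u x) integrable_on cbox a b" for u v
      by (intro integrable_continuous continuous_intros continuous_on_dbump continuous_on_subset[OF cont1 ab])
    ultimately show "integral (cbox a b) (\<lambda>x. dbump c r 1 x v * ?f u x + dbump c r 1 x u * - ?f v x) = 0"
      by (simp add: integral_diff)
  qed auto
  then show ?thesis by simp
qed

section \<open>The complex area form and the first variation of area\<close>

definition \<Omega> :: "complex^2 \<Rightarrow> complex^2 \<Rightarrow> complex" where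
  "\<Omega> v w = v$1 * w$2 - v$2 * w$1"

lemma bounded_bilinear_\<Omega>: "bounded_bilinear \<Omega>"
proof
  show "\<exists>K. \<forall>a b. norm (\<Omega> a b) \<le> norm a * norm b * K"
  proof (intro exI allI)
    fix a b :: "complex^2"
    have "norm (\<Omega> a b) \<le> norm (a$1) * norm (b$2) + norm (a$2) * norm (b$1)"
      unfolding \<Omega>_def by (metis norm_mult norm_triangle_ineq4)
    also have "\<dots> \<le> norm a * norm b + norm a * norm b"
      by (intro add_mono mult_mono) (auto simp: Finite_Cartesian_Product.norm_nth_le)
    finally show "norm (\<Omega> a b) \<le> norm a * norm b * 2" by simp
  qed
qed (auto simp: \<Omega>_def algebra_simps)

interpretation \<Omega>: bounded_bilinear \<Omega> by (rule bounded_bilinear_\<Omega>)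

lemma bounded_bilinear_\<omega>1: "bounded_bilinear \<omega>1"
proof
  show "\<exists>K. \<forall>a b. norm (\<omega>1 a b) \<le> norm a * norm b * K"
  proof (intro exI allI)
    fix a b :: "complex^2"
    have "norm (\<omega>1 a b) \<le> norm (herm1 a b)"
      unfolding \<omega>1_def using abs_Im_le_cmod by simp
    also have "\<dots> \<le> norm (a$1) * norm (b$1) + norm (a$2) * norm (b$2)"
      unfolding herm1_def by (metis norm_mult norm_triangle_ineq norm_minus_cancel complex_mod_cnj)
    also have "\<dots> \<le> norm a * norm b + norm a * norm b"
      by (intro add_mono mult_mono) (auto simp: Finite_Cartesian_Product.norm_nth_le)
    finally show "norm (\<omega>1 a b) \<le> norm a * norm b * 2" by simp
  qed
qed (auto simp: \<omega>1_def herm1_def algebra_simps)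

interpretation \<omega>1: bounded_bilinear \<omega>1 by (rule bounded_bilinear_\<omega>1)

lemma \<Omega>_self [simp]: "\<Omega> v v = 0"
  by (simp add: \<Omega>_def)

lemma \<omega>1_self [simp]: "\<omega>1 v v = 0"
  by (simp add: \<omega>1_def herm1_def)

text \<open>The Hermitian form has determinant -1, so its complex Gram determinant, herm(v,v)
  herm(w,w) - |herm(v,w)|^2, is - |\<Omega>(v,w)|^2. Splitting |herm(v,w)|^2 into the squares of
  \<open>metric2\<close> and \<open>\<omega>1\<close> gives the real one.\<close>

lemma gram_determinant:
  "metric2 v v * metric2 w w - metric2 v w * metric2 w v = (\<omega>1 v w)\<^sup>2 - (cmod (\<Omega> v w))\<^sup>2"
  unfolding metric2_def \<omega>1_def herm1_def \<Omega>_def cmod_power2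
  by (simp add: power2_eq_square) algebra

definition D\<^sub>1 :: "(real^2 \<Rightarrow> 'b::euclidean_space) \<Rightarrow> real^2 \<Rightarrow> 'b" where
  "D\<^sub>1 f x = frechet_derivative f (at x) (axis 1 1)"

definition D\<^sub>2 :: "(real^2 \<Rightarrow> 'b::euclidean_space) \<Rightarrow> real^2 \<Rightarrow> 'b" where
  "D\<^sub>2 f x = frechet_derivative f (at x) (axis 2 1)"

lemma det_first_fundamental_form:
  "det (first_fundamental_form F x) = (\<omega>1 (D\<^sub>1 F x) (D\<^sub>2 F x))\<^sup>2 - (cmod (\<Omega> (D\<^sub>1 F x) (D\<^sub>2 F x)))\<^sup>2"
  by (simp add: det_2 first_fundamental_form_def D\<^sub>1_def D\<^sub>2_def gram_determinant)

section \<open>Differentiation of the area integral\<close>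

text \<open>Differentiating under the integral needs the radicand positive for small t, uniformly in
  x. Compactness of the box provides a positive lower bound for \<alpha> and upper bounds for
  |\<beta>| and |\<gamma>|.\<close>

lemma integral_sqrt_variation:
  fixes \<alpha> \<beta> \<gamma> :: "'a::euclidean_space \<Rightarrow> real"
  assumes cont: "continuous_on (cbox a b) \<alpha>" "continuous_on (cbox a b) \<beta>" "continuous_on (cbox a b) \<gamma>"
    and pos: "\<And>x. x \<in> cbox a b \<Longrightarrow> \<alpha> x > 0"
  shows "((\<lambda>t. integral (cbox a b) (\<lambda>x. sqrt \<bar>\<alpha> x + 2 * t * \<beta> x + t\<^sup>2 * \<gamma> x\<bar>)) has_real_derivative
    integral (cbox a b) (\<lambda>x. \<beta> x / sqrt (\<alpha> x))) (at 0)"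
proof (cases "cbox a b = {}")
  case False
  let ?R = "\<lambda>t x. \<alpha> x + 2 * t * \<beta> x + t\<^sup>2 * \<gamma> x"
  obtain m where m: "m > 0" "\<And>x. x \<in> cbox a b \<Longrightarrow> m \<le> \<alpha> x"
    using continuous_attains_inf[OF compact_cbox False cont(1)] pos by metis
  obtain B where B: "\<And>x. x \<in> cbox a b \<Longrightarrow> \<bar>\<beta> x\<bar> \<le> B"
    using compact_imp_bounded[OF compact_continuous_image[OF cont(2) compact_cbox]]
    unfolding bounded_iff by auto
  obtain C where C: "\<And>x. x \<in> cbox a b \<Longrightarrow> \<bar>\<gamma> x\<bar> \<le> C"
    using compact_imp_bounded[OF compact_continuous_image[OF cont(3) compact_cbox]]
    unfolding bounded_iff by auto
  have BC: "B \<ge> 0" "C \<ge> 0" using B C False by force+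
  \<comment> \<open>For |t| < d <= 1 the perturbation is at most d (2 B + C), strictly below m; the
    extra 1 gives the strictness and a positive denominator.\<close>
  define d where "d = min 1 (m / (2 * B + C + 1))"
  have d: "0 < d" "d \<le> 1" "d * (2 * B + C + 1) \<le> m"
    using m(1) BC pos_le_divide_eq[of "2 * B + C + 1" d m] by (auto simp: d_def)
  have R: "?R t x > 0" if t: "t \<in> {-d<..<d}" and x: "x \<in> cbox a b" for t x
  proof -
    have t1: "\<bar>t\<bar> \<le> d" "\<bar>t\<bar> \<le> 1" using t d by auto
    have "\<bar>2 * t * \<beta> x + t\<^sup>2 * \<gamma> x\<bar> \<le> 2 * \<bar>t\<bar> * \<bar>\<beta> x\<bar> + \<bar>t\<bar> * (\<bar>t\<bar> * \<bar>\<gamma> x\<bar>)"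
      by (rule order_trans[OF abs_triangle_ineq]) (simp add: abs_mult power2_eq_square)
    also have "\<dots> \<le> 2 * d * B + d * (1 * C)"
      using t1 B[OF x] C[OF x] BC d by (intro add_mono mult_mono) auto
    also have "\<dots> < m" using d by (simp add: algebra_simps)
    finally show ?thesis using m(2)[OF x] by linarith
  qed
  note ci = continuous_on_compose2[OF cont(1)] continuous_on_compose2[OF cont(2)] continuous_on_compose2[OF cont(3)]
  have "((\<lambda>t. integral (cbox a b) (\<lambda>x. sqrt \<bar>?R t x\<bar>)) has_real_derivative
    integral (cbox a b) (\<lambda>x. (\<beta> x + 0 * \<gamma> x) / sqrt (?R 0 x))) (at 0 within {-d<..<d})"
  proof (rule leibniz_rule_field_derivative[where fx = "\<lambda>t x. (\<beta> x + t * \<gamma> x) / sqrt (?R t x)"])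
    fix t x assume tx: "t \<in> {-d<..<d}" "x \<in> cbox a b"
    have "((\<lambda>t. sqrt (?R t x)) has_real_derivative (\<beta> x + t * \<gamma> x) / sqrt (?R t x)) (at t)"
      using R[OF tx] by (auto intro!: derivative_eq_intros simp: field_simps)
    then have "((\<lambda>t. sqrt \<bar>?R t x\<bar>) has_real_derivative (\<beta> x + t * \<gamma> x) / sqrt (?R t x)) (at t)"
      by (rule has_field_derivative_transform_within_open[where S = "{-d<..<d}"]) (use tx R in force)+
    then show "((\<lambda>t. sqrt \<bar>?R t x\<bar>) has_real_derivative (\<beta> x + t * \<gamma> x) / sqrt (?R t x)) (at t within {-d<..<d})"
      by (rule has_field_derivative_at_within)
  next
    show "(\<lambda>x. sqrt \<bar>?R t x\<bar>) integrable_on cbox a b" for t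
      by (intro integrable_continuous continuous_intros cont)
    show "continuous_on ({-d<..<d} \<times> cbox a b) (\<lambda>(t, x). (\<beta> x + t * \<gamma> x) / sqrt (?R t x))"
      unfolding split_beta
    proof (intro continuous_intros ci)
      show "\<forall>z\<in>{-d<..<d} \<times> cbox a b. sqrt (?R (fst z) (snd z)) \<noteq> 0"
        using R by fastforce
    qed auto
  qed (use d in auto)
  then show ?thesis using d by (simp add: at_within_open[of 0 "{-d<..<d}"])
qed simp

section \<open>Constancy of the phase of a critical parametrization\<close>

lemma Ck_on_\<Omega>: "open S \<Longrightarrow> Ck_on k S f \<Longrightarrow> Ck_on k S g \<Longrightarrow> Ck_on k S (\<lambda>x. \<Omega> (f x) (g x))"
  by (rule Ck_on_bilinear[OF _ bounded_bilinear_\<Omega>])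

text \<open>Since sgn f = (f . f)^(-1/2) f, the claim reduces to powers of positive reals.\<close>

lemma Ck_on_sgn:
  fixes f :: "'a::euclidean_space \<Rightarrow> 'b::euclidean_space"
  assumes "open S" "Ck_on k S f" "\<And>x. x \<in> S \<Longrightarrow> f x \<noteq> 0"
  shows "Ck_on k S (\<lambda>x. sgn (f x))"
proof -
  have "Ck_on k S (\<lambda>x. ((f x \<bullet> f x) powr (- 1 / 2)) *\<^sub>R f x)"
    by (rule Ck_on_bilinear[OF assms(1) bounded_bilinear_scaleR
          Ck_on_compose[OF assms(1) open_greaterThan _ Ck_on_powr
            Ck_on_bilinear[OF assms(1) bounded_bilinear_inner assms(2,2)]] assms(2)])
      (use assms(3) in auto)
  moreover have "((f x \<bullet> f x) powr (- 1 / 2)) *\<^sub>R f x = sgn (f x)" for x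
    by (simp add: sgn_div_norm norm_eq_sqrt_inner powr_minus powr_half_sqrt)
  ultimately show ?thesis by simp
qed

lemma D\<^sub>1_D\<^sub>2_commute:
  fixes f :: "real^2 \<Rightarrow> 'b::euclidean_space"
  assumes D: "open D" and f: "Ck_on 2 D f" and x: "x \<in> D"
  shows "D\<^sub>1 (D\<^sub>2 f) x = D\<^sub>2 (D\<^sub>1 f) x"
proof (rule euclidean_eqI)
  fix b :: 'b
  have f1: "Ck_on (Suc 0) D (\<lambda>x. frechet_derivative f (at x) u)" for u
    using f by (simp add: numeral_2_eq_2)
  have f0: "Ck_on (Suc 0) D f" using f Ck_on_pred[OF D, of 1 f] by (simp add: numeral_2_eq_2)
  have inner: "frechet_derivative (\<lambda>x. g x \<bullet> b) (at x) u = frechet_derivative g (at x) u \<bullet> b"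
    if "Ck_on (Suc 0) D g" "x \<in> D" for g :: "real^2 \<Rightarrow> 'b" and x u
    using frechet_derivative_at[OF has_derivative_inner_left[OF Ck_on_has_derivative[OF D that]]]
    by metis
  have fb: "Ck_on 2 D (\<lambda>x. f x \<bullet> b)"
    by (rule Ck_on_linear_compose[OF D bounded_linear_inner_left f])
  have "frechet_derivative (\<lambda>x. frechet_derivative (\<lambda>x. f x \<bullet> b) (at x) u) (at x) v =
    frechet_derivative (\<lambda>x. frechet_derivative f (at x) u) (at x) v \<bullet> b" for u v
  proof -
    have "((\<lambda>x. frechet_derivative f (at x) u \<bullet> b) has_derivative
        (\<lambda>v. frechet_derivative (\<lambda>x. frechet_derivative f (at x) u) (at x) v \<bullet> b)) (at x)"
      by (rule has_derivative_inner_left[OF Ck_on_has_derivative[OF D f1 x]])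
    then have "((\<lambda>x. frechet_derivative (\<lambda>x. f x \<bullet> b) (at x) u) has_derivative
        (\<lambda>v. frechet_derivative (\<lambda>x. frechet_derivative f (at x) u) (at x) v \<bullet> b)) (at x)"
      by (rule has_derivative_transform_within_open[OF _ D x]) (simp add: inner[OF f0])
    then show ?thesis by (metis frechet_derivative_at)
  qed
  with frechet_derivative_symmetric[OF D fb x, of "axis 2 1" "axis 1 1"]
  show "D\<^sub>1 (D\<^sub>2 f) x \<bullet> b = D\<^sub>2 (D\<^sub>1 f) x \<bullet> b"
    by (simp add: D\<^sub>1_def[abs_def] D\<^sub>2_def[abs_def])
qed

lemma linear_real2_axes:
  fixes L :: "real^2 \<Rightarrow> 'b::real_vector"
  assumes "linear L"
  shows "L v = (v$1) *\<^sub>R L (axis 1 1) + (v$2) *\<^sub>R L (axis 2 1)"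
proof -
  have "v = (v$1) *\<^sub>R axis 1 1 + (v$2) *\<^sub>R axis 2 1"
    by (simp add: vec_eq_iff forall_2 axis_def)
  from arg_cong[OF this, of L] show ?thesis
    by (simp only: linear_add[OF assms] linear_scale[OF assms])
qed

text \<open>
  Here \<open>sgn \<circ> \<Omega>\<close> is the exponential of the Lagrangian angle, so this is the statement that the
  Lagrangian angle of a minimal surface is constant.
\<close>

lemma critical_imp_phase_derivative_0:
  fixes w :: "real^2 \<Rightarrow> complex^2"
  assumes D: "open D" and w: "Ck_on 2 D w"
    and nz: "\<And>x. x \<in> D \<Longrightarrow> \<Omega> (D\<^sub>1 w x) (D\<^sub>2 w x) \<noteq> 0"
    and crit: "\<And>c r a b V. 0 < r \<Longrightarrow> cball c (2 * r) \<subseteq> cbox a b \<Longrightarrow> cbox a b \<subseteq> D \<Longrightarrow>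
      integral (cbox a b) (\<lambda>x. Re (cnj (sgn (\<Omega> (D\<^sub>1 w x) (D\<^sub>2 w x))) *
        (dbump c r 1 x (axis 1 1) *\<^sub>R \<Omega> V (D\<^sub>2 w x) + dbump c r 1 x (axis 2 1) *\<^sub>R \<Omega> (D\<^sub>1 w x) V))) = 0"
    and x: "x \<in> D"
  shows "((\<lambda>x. sgn (\<Omega> (D\<^sub>1 w x) (D\<^sub>2 w x))) has_derivative (\<lambda>v. 0)) (at x)"
proof -
  define u where "u x = sgn (\<Omega> (D\<^sub>1 w x) (D\<^sub>2 w x))" for x
  let ?U = "\<lambda>x. frechet_derivative u (at x)"
  let ?P = "\<lambda>x. frechet_derivative (D\<^sub>1 w) (at x)" and ?Q = "\<lambda>x. frechet_derivative (D\<^sub>2 w) (at x)"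
  have P: "Ck_on 1 D (D\<^sub>1 w)" and Q: "Ck_on 1 D (D\<^sub>2 w)"
    using w by (simp_all add: D\<^sub>1_def[abs_def] D\<^sub>2_def[abs_def] numeral_2_eq_2)
  have u: "Ck_on 1 D u"
    unfolding u_def by (intro Ck_on_sgn Ck_on_\<Omega> D P Q nz)
  have dP: "(D\<^sub>1 w has_derivative ?P x) (at x)" and dQ: "(D\<^sub>2 w has_derivative ?Q x) (at x)"
    and du: "(u has_derivative ?U x) (at x)" if "x \<in> D" for x
    using Ck_on_has_derivative[OF D _ that, of 0] P Q u by simp_all
  have cont: "continuous_on D (D\<^sub>1 w)" "continuous_on D (D\<^sub>2 w)" "continuous_on D u"
    by (rule Ck_on_continuous_on[OF D P] Ck_on_continuous_on[OF D Q] Ck_on_continuous_on[OF D u])+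
  have cont': "continuous_on D (\<lambda>x. ?P x v)" "continuous_on D (\<lambda>x. ?Q x v)" "continuous_on D (\<lambda>x. ?U x v)" for v
    using P Q u by simp_all
  have eq: "Re (cnj (?U x (axis 1 1)) * \<Omega> V (D\<^sub>2 w x)) + Re (cnj (?U x (axis 2 1)) * \<Omega> (D\<^sub>1 w x) V) = 0" for V
  proof -
    let ?G' = "\<lambda>x v. Re (cnj (u x) * \<Omega> V (?Q x v) + cnj (?U x v) * \<Omega> V (D\<^sub>2 w x))"
    let ?H' = "\<lambda>x v. Re (cnj (u x) * \<Omega> (?P x v) V + cnj (?U x v) * \<Omega> (D\<^sub>1 w x) V)"
    \<comment> \<open>Criticality is the weak form of a vanishing divergence. The pointwise form has
      derivatives on the phase \<open>u\<close> and on the tangent vectors.\<close>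
    have "?G' x (axis 1 1) + ?H' x (axis 2 1) = 0"
    proof (rule weakly_divergence_free[where G = "\<lambda>x. Re (cnj (u x) * \<Omega> V (D\<^sub>2 w x))"
          and H = "\<lambda>x. Re (cnj (u x) * \<Omega> (D\<^sub>1 w x) V)" and G' = ?G' and H' = ?H', OF D _ _ _ _ _ x])
      fix x assume x: "x \<in> D"
      show "((\<lambda>x. Re (cnj (u x) * \<Omega> V (D\<^sub>2 w x))) has_derivative ?G' x) (at x)"
        by (intro has_derivative_Re has_derivative_mult has_derivative_cnj du[OF x]
            bounded_linear.has_derivative[OF \<Omega>.bounded_linear_right] dQ[OF x])
      show "((\<lambda>x. Re (cnj (u x) * \<Omega> (D\<^sub>1 w x) V)) has_derivative ?H' x) (at x)"
        by (intro has_derivative_Re has_derivative_mult has_derivative_cnj du[OF x]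
            bounded_linear.has_derivative[OF \<Omega>.bounded_linear_left] dP[OF x])
    next
      show "continuous_on D (\<lambda>x. ?G' x (axis 1 1))" "continuous_on D (\<lambda>x. ?H' x (axis 2 1))"
        by (intro continuous_intros \<Omega>.continuous_on cont cont')+
    next
      fix c r a b assume "0 < r" "cball c (2 * r) \<subseteq> cbox a b" "cbox a b \<subseteq> D"
      from crit[OF this, of V]
      show "integral (cbox a b) (\<lambda>x. dbump c r 1 x (axis 1 1) * Re (cnj (u x) * \<Omega> V (D\<^sub>2 w x)) +
        dbump c r 1 x (axis 2 1) * Re (cnj (u x) * \<Omega> (D\<^sub>1 w x) V)) = 0"
        by (simp add: u_def algebra_simps)
    qed
    \<comment> \<open>The second derivatives of \<open>w\<close> cancel, because the mixed ones
      agree and \<Omega> is antisymmetric; only derivatives of the phase remain.\<close>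
    moreover have "?Q x (axis 1 1) = ?P x (axis 2 1)"
      using D\<^sub>1_D\<^sub>2_commute[OF D w x] by (simp add: D\<^sub>1_def[of "D\<^sub>2 w"] D\<^sub>2_def[of "D\<^sub>1 w"])
    ultimately show ?thesis by (simp add: \<Omega>_def algebra_simps)
  qed
  have \<Omega>i: "\<Omega> (\<i> *s v) z = \<i> * \<Omega> v z" "\<Omega> v (\<i> *s z) = \<i> * \<Omega> v z" for v z
    by (simp_all add: \<Omega>_def algebra_simps)
  have 0: "z = 0" if "Re (cnj z * a) = 0" "Re (cnj z * (\<i> * a)) = 0" "a \<noteq> 0" for z a
  proof -
    have "cnj z * a = 0" using that by (simp add: complex_eq_iff)
    then show ?thesis using that(3) by simp
  qed
  \<comment> \<open>Taking for \<open>V\<close> the first tangent vector kills the second summand.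
    With i times that vector as well, the full complex product of the conjugated phase derivative
    and \<Omega> vanishes, and \<Omega> is nonzero. The other tangent vector gives the other partial
    derivative.\<close>
  have "?U x (axis 1 1) = 0"
    using eq[of "D\<^sub>1 w x"] eq[of "\<i> *s D\<^sub>1 w x"] unfolding \<Omega>i \<Omega>_self
    by (intro 0[OF _ _ nz[OF x]]) simp_all
  moreover have "?U x (axis 2 1) = 0"
    using eq[of "D\<^sub>2 w x"] eq[of "\<i> *s D\<^sub>2 w x"] unfolding \<Omega>i \<Omega>_self
    by (intro 0[OF _ _ nz[OF x]]) simp_all
  ultimately have "?U x v = 0" for v
    by (subst linear_real2_axes[OF has_derivative_linear[OF du[OF x]]]) simp
  then have "?U x = (\<lambda>v. 0)" by blast
  with du[OF x] show ?thesis by (simp add: u_def[abs_def])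
qed

section \<open>Charts and variations\<close>

lemma metric2_linear_combination:
  "metric2 (a *\<^sub>R v + b *\<^sub>R w) z = a * metric2 v z + b * metric2 w z"
  by (simp add: metric2_def herm1_def algebra_simps)

lemma metric2_commute: "metric2 v w = metric2 w v"
  by (simp add: metric2_def herm1_def algebra_simps)

lemma chartD:
  assumes "smooth_surface M A" "(D, \<phi>) \<in> A"
  shows "open D" "inj_on \<phi> D" "openin M (\<phi> ` D)"
    "homeomorphic_map (top_of_set D) (subtopology M (\<phi> ` D)) \<phi>"
    "continuous_map (top_of_set D) M \<phi>"
proof -
  show "open D" "openin M (\<phi> ` D)"
    and hom: "homeomorphic_map (top_of_set D) (subtopology M (\<phi> ` D)) \<phi>"
    using assms by (auto simp: smooth_surface_def)
  show "inj_on \<phi> D"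
    using homeomorphic_imp_injective_map[OF hom] by simp
  show "continuous_map (top_of_set D) M \<phi>"
    using homeomorphic_imp_continuous_map[OF hom] continuous_map_in_subtopology by blast
qed

lemma openin_chart_image:
  assumes M: "smooth_surface M A" "(D, \<phi>) \<in> A" and U: "open U" "U \<subseteq> D"
  shows "openin M (\<phi> ` U)"
proof -
  have "openin (subtopology M (\<phi> ` D)) (\<phi> ` U)"
    using homeomorphic_imp_open_map[OF chartD(4)[OF M]] U
    by (simp add: open_map_def open_subset)
  then show ?thesis using chartD(3)[OF M] openin_trans_full by blast
qed

lemma open_chart_preimage:
  assumes M: "smooth_surface M A" "(D, \<phi>) \<in> A" and U: "openin M U"
  shows "open {x \<in> D. \<phi> x \<in> U}"
  using openin_continuous_map_preimage[OF chartD(5)[OF M] U] chartD(1)[OF M]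
  by (simp add: openin_open_eq)

lemma chart_derivative_axes:
  assumes f: "immersed_surface M A f" "(D, \<phi>) \<in> A" "x \<in> D"
  shows "frechet_derivative (f \<circ> \<phi>) (at x) v =
    (v$1) *\<^sub>R D\<^sub>1 (f \<circ> \<phi>) x + (v$2) *\<^sub>R D\<^sub>2 (f \<circ> \<phi>) x"
proof -
  have "smooth_on D (f \<circ> \<phi>)" and D: "open D"
    using f chartD(1)[of M A D \<phi>] by (auto simp: immersed_surface_def)
  then have "linear (frechet_derivative (f \<circ> \<phi>) (at x))"
    using Ck_on_has_derivative[OF D _ f(3), of 0 "f \<circ> \<phi>"] has_derivative_linear
    unfolding smooth_on_def by blast
  then show ?thesis unfolding D\<^sub>1_def D\<^sub>2_def by (rule linear_real2_axes)
qed

text \<open>On a Lagrangian tangent plane the Gram determinant is - |\<Omega>|^2. If it vanished, a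
  kernel vector of the Gram matrix would be a nonzero tangent vector orthogonal to the whole tangent
  plane.\<close>

lemma nondegenerate_lagrangian_\<Omega>_nonzero:
  assumes nd: "nondegenerate_surface M A f" and lag: "lagrangian_surface M A f"
    and D: "(D, \<phi>) \<in> A" "x \<in> D"
  shows "\<Omega> (D\<^sub>1 (f \<circ> \<phi>) x) (D\<^sub>2 (f \<circ> \<phi>) x) \<noteq> 0"
proof
  let ?P = "D\<^sub>1 (f \<circ> \<phi>) x" and ?Q = "D\<^sub>2 (f \<circ> \<phi>) x"
  assume 0: "\<Omega> ?P ?Q = 0"
  have imm: "immersed_surface M A f" using lag by (simp add: lagrangian_surface_def)
  note ax = chart_derivative_axes[OF imm D]
  have "\<omega>1 ?P ?Q = 0"
    using lag D unfolding lagrangian_surface_def D\<^sub>1_def D\<^sub>2_def by fast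
  with gram_determinant[of ?P ?Q] 0
  have g: "metric2 ?P ?P * metric2 ?Q ?Q = metric2 ?P ?Q * metric2 ?P ?Q"
    by (simp add: metric2_commute[of ?Q ?P])
  have nd: "\<exists>w :: real^2. metric2 (v$1 *\<^sub>R ?P + v$2 *\<^sub>R ?Q) (w$1 *\<^sub>R ?P + w$2 *\<^sub>R ?Q) \<noteq> 0"
    if "v \<noteq> 0" for v :: "real^2"
  proof -
    have "\<exists>w. metric2 (frechet_derivative (f \<circ> \<phi>) (at x) v) (frechet_derivative (f \<circ> \<phi>) (at x) w) \<noteq> 0"
      using nd D that unfolding nondegenerate_surface_def by fast
    then show ?thesis by (simp only: ax)
  qed
  have expand: "metric2 (a *\<^sub>R ?P + b *\<^sub>R ?Q) (c *\<^sub>R ?P + d *\<^sub>R ?Q) =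
    a * c * metric2 ?P ?P + (a * d + b * c) * metric2 ?P ?Q + b * d * metric2 ?Q ?Q" for a b c d
    unfolding metric2_linear_combination metric2_commute[of ?P "c *\<^sub>R ?P + d *\<^sub>R ?Q"]
      metric2_commute[of ?Q "c *\<^sub>R ?P + d *\<^sub>R ?Q"]
    by (simp add: metric2_commute[of ?Q ?P] algebra_simps)
  show False
  proof (cases "metric2 ?P ?P = 0 \<and> metric2 ?P ?Q = 0")
    case True
    have "vector [1, 0] \<noteq> (0 :: real^2)" by (simp add: vec_eq_iff forall_2)
    from nd[OF this] True show False unfolding expand by simp
  next
    case False
    \<comment> \<open>A singular symmetric 2 x 2 matrix with nonzero first row (g11, g12)
      annihilates (- g12, g11).\<close>
    let ?v = "vector [- metric2 ?P ?Q, metric2 ?P ?P] :: real^2"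
    have "?v \<noteq> 0" using False by (auto simp: vec_eq_iff forall_2)
    then obtain c d where "metric2 (- metric2 ?P ?Q *\<^sub>R ?P + metric2 ?P ?P *\<^sub>R ?Q) (c *\<^sub>R ?P + d *\<^sub>R ?Q) \<noteq> 0"
      using nd[of ?v] by auto
    moreover have "- metric2 ?P ?Q * c * metric2 ?P ?P + (- metric2 ?P ?Q * d + metric2 ?P ?P * c) * metric2 ?P ?Q
      + metric2 ?P ?P * d * metric2 ?Q ?Q = d * (metric2 ?P ?P * metric2 ?Q ?Q - metric2 ?P ?Q * metric2 ?P ?Q)"
      by (simp add: algebra_simps)
    ultimately show False unfolding expand using g by simp
  qed
qed

section \<open>Variations supported in one chart\<close>

text \<open>Localisation is left to \<open>h\<close>; keeping \<open>V\<close> constant makes the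
  coordinate tangent vectors affine in t, with increments that are multiples of
  \<open>V\<close>.\<close>

definition chart_variation ::
  "(real^2) set \<Rightarrow> (real^2 \<Rightarrow> 'a) \<Rightarrow> ('a \<Rightarrow> complex^2) \<Rightarrow> (real^2 \<Rightarrow> real) \<Rightarrow> complex^2 \<Rightarrow> real \<Rightarrow> 'a \<Rightarrow> complex^2" where
  "chart_variation D \<phi> f h V t p = f p + (t * (if p \<in> \<phi> ` D then h (inv_into D \<phi> p) else 0)) *\<^sub>R V"

text \<open>In another chart, smoothness is checked on two open sets: over the range of
  \<open>\<phi>\<close> the transition map is smooth, and off the image of \<open>S\<close> the
  perturbation is zero. The second set is open because compact sets are closed in a Hausdorff
  space.\<close>

lemma compactly_supported_chart_variation:
  assumes f: "immersed_surface M A f" and D: "(D, \<phi>) \<in> A"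
    and h: "smooth_on UNIV h" and S: "compact S" "S \<subseteq> D" and supp: "\<And>x. x \<notin> S \<Longrightarrow> h x = 0"
  shows "compactly_supported_variation M A f (\<phi> ` S) 1 (chart_variation D \<phi> f h V)"
  unfolding compactly_supported_variation_def
proof (intro conjI)
  have M: "smooth_surface M A" using f by (simp add: immersed_surface_def)
  have Haus: "Hausdorff_space M" using M by (simp add: smooth_surface_def)
  note ch = chartD[OF M D]
  have comp: "compactin M (\<phi> ` S)"
    by (rule image_compactin[OF _ ch(5)]) (use S in \<open>simp add: compactin_subtopology\<close>)
  then show "compactin M (\<phi> ` S)" .
  show "\<forall>p\<in>topspace M. chart_variation D \<phi> f h V 0 p = f p"
    by (simp add: chart_variation_def)
  have zero: "h (inv_into D \<phi> p) = 0" if "p \<in> \<phi> ` D" "p \<notin> \<phi> ` S" for p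
    using supp[of "inv_into D \<phi> p"] f_inv_into_f[OF that(1)] that(2) imageI by metis
  then show "\<forall>t\<in>{- 1<..<1}. \<forall>p\<in>topspace M - \<phi> ` S. chart_variation D \<phi> f h V t p = f p"
    by (simp add: chart_variation_def)
  show "\<forall>(E, \<psi>)\<in>A. smooth_on ({- 1<..<1} \<times> E) (\<lambda>(t, x). chart_variation D \<phi> f h V t (\<psi> x))"
  proof clarify
    fix E \<psi> assume E: "(E, \<psi>) \<in> A"
    note chE = chartD[OF M E]
    let ?k = "\<lambda>y. if \<psi> y \<in> \<phi> ` D then h (inv_into D \<phi> (\<psi> y)) else 0"
    let ?E1 = "{y \<in> E. \<psi> y \<in> \<phi> ` D}" and ?E2 = "{y \<in> E. \<psi> y \<in> topspace M - \<phi> ` S}"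
    have o1: "open ?E1" by (rule open_chart_preimage[OF M E ch(3)])
    have o2: "open ?E2"
      by (rule open_chart_preimage[OF M E]) (use compactin_imp_closedin[OF Haus comp] in blast)
    have ET: "\<psi> y \<in> topspace M" if "y \<in> E" for y
      using chE(5) that by (auto simp: continuous_map_def)
    have cover: "E = ?E1 \<union> ?E2" using ET S(2) by auto
    have k1: "Ck_on n ?E1 ?k" for n
    proof -
      have "Ck_on n ?E1 (inv_into D \<phi> \<circ> \<psi>)"
        using M D E unfolding smooth_surface_def smooth_on_def by fast
      from Ck_on_compose[OF o1 open_UNIV _ _ this, of h] h
      have "Ck_on n ?E1 (\<lambda>y. h ((inv_into D \<phi> \<circ> \<psi>) y))" by (simp add: smooth_on_def)
      then show ?thesis by (subst Ck_on_cong[OF o1]) auto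
    qed
    have k2: "Ck_on n ?E2 ?k" for n
    proof (subst Ck_on_cong[OF o2, where g = "\<lambda>_. 0"])
      fix y assume "y \<in> ?E2"
      then show "?k y = 0" using zero by simp
    qed (rule Ck_on_const[OF o2])
    have k: "Ck_on n E ?k" for n
      by (subst cover) (rule Ck_on_Un[OF o1 o2 k1 k2])
    have fE: "Ck_on n E (\<lambda>x. f (\<psi> x))" for n
      using f E unfolding immersed_surface_def smooth_on_def o_def by fast
    let ?U = "{- 1<..<1::real} \<times> E"
    have oU: "open ?U" by (intro open_Times chE(1)) auto
    have snd: "Ck_on n ?U snd" for n by (rule Ck_on_linear[OF oU bounded_linear_snd])
    have fst: "Ck_on n ?U fst" for n by (rule Ck_on_linear[OF oU bounded_linear_fst])
    have "Ck_on n ?U (\<lambda>z. f (\<psi> (snd z)) + (fst z * ?k (snd z)) *\<^sub>R V)" for n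
      by (intro Ck_on_add[OF oU] Ck_on_compose[OF oU chE(1) _ fE snd] Ck_on_bilinear[OF oU bounded_bilinear_scaleR]
          Ck_on_bilinear[OF oU bounded_bilinear_mult] fst Ck_on_compose[OF oU chE(1) _ k snd] Ck_on_const[OF oU]) auto
    then show "smooth_on ?U (\<lambda>(t, x). chart_variation D \<phi> f h V t (\<psi> x))"
      unfolding smooth_on_def chart_variation_def split_beta by blast
  qed
qed simp

text \<open>Along the variation \<Omega> of the tangent vectors is affine in t, because \<Omega>(V,
  V) = 0, and \<open>\<omega>1\<close> is linear in t, starting at 0. The area density is thus an
  explicit square root; minimality makes the derivative of its integral zero.\<close>

lemma minimal_lagrangian_critical:
  assumes min: "minimal_surface M A f" and lag: "lagrangian_surface M A f" and D: "(D, \<phi>) \<in> A"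
    and r: "0 < r" "cball c (2 * r) \<subseteq> cbox a b" and ab: "cbox a b \<subseteq> D"
  defines "w \<equiv> f \<circ> \<phi>"
  shows "integral (cbox a b) (\<lambda>x. Re (cnj (sgn (\<Omega> (D\<^sub>1 w x) (D\<^sub>2 w x))) *
        (dbump c r 1 x (axis 1 1) *\<^sub>R \<Omega> V (D\<^sub>2 w x) + dbump c r 1 x (axis 2 1) *\<^sub>R \<Omega> (D\<^sub>1 w x) V))) = 0"
proof -
  have imm: "immersed_surface M A f" using lag by (simp add: lagrangian_surface_def)
  have nd: "nondegenerate_surface M A f" using min by (simp add: minimal_surface_def)
  have M: "smooth_surface M A" using imm by (simp add: immersed_surface_def)
  note ch = chartD[OF M D]
  let ?h = "bump c r 1" and ?h1 = "\<lambda>x. dbump c r 1 x (axis 1 1)" and ?h2 = "\<lambda>x. dbump c r 1 x (axis 2 1)"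
  have w: "Ck_on n D w" for n
    using imm D unfolding immersed_surface_def smooth_on_def w_def by fast
  have P: "continuous_on D (D\<^sub>1 w)" and Q: "continuous_on D (D\<^sub>2 w)"
    using w[of 1] by (simp_all add: D\<^sub>1_def[abs_def] D\<^sub>2_def[abs_def])
  note PQ = continuous_on_subset[OF P ab] continuous_on_subset[OF Q ab]
  define \<Omega>0 where "\<Omega>0 x = \<Omega> (D\<^sub>1 w x) (D\<^sub>2 w x)" for x
  define B where "B x = ?h1 x *\<^sub>R \<Omega> V (D\<^sub>2 w x) + ?h2 x *\<^sub>R \<Omega> (D\<^sub>1 w x) V" for x
  define b' where "b' x = ?h1 x * \<omega>1 V (D\<^sub>2 w x) + ?h2 x * \<omega>1 (D\<^sub>1 w x) V" for x
  have cont: "continuous_on (cbox a b) \<Omega>0" "continuous_on (cbox a b) B" "continuous_on (cbox a b) b'"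
    unfolding \<Omega>0_def B_def b'_def
    by (intro continuous_intros \<Omega>.continuous_on \<omega>1.continuous_on PQ continuous_on_dbump)+
  have nz: "\<Omega>0 x \<noteq> 0" if "x \<in> D" for x
    using nondegenerate_lagrangian_\<Omega>_nonzero[OF nd lag D that] by (simp add: \<Omega>0_def w_def)
  define F where "F = chart_variation D \<phi> f ?h V"
  \<comment> \<open>The negative of the Gram determinant, |\<open>\<Omega>0\<close> + t B|^2 - (t
    b')^2, expanded in powers of t.\<close>
  let ?R = "\<lambda>t x. (cmod (\<Omega>0 x))\<^sup>2 + 2 * t * Re (cnj (\<Omega>0 x) * B x) + t\<^sup>2 * ((cmod (B x))\<^sup>2 - (b' x)\<^sup>2)"
  have density: "area_density (F t \<circ> \<phi>) x = sqrt \<bar>?R t x\<bar>" if x: "x \<in> D" for t x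
  proof -
    have "((\<lambda>y. w y + (t * ?h y) *\<^sub>R V) has_derivative
        (\<lambda>v. frechet_derivative w (at x) v + (t * dbump c r 1 x v) *\<^sub>R V)) (at x)"
      by (auto intro!: derivative_eq_intros Ck_on_has_derivative[OF ch(1) w[of "Suc 0"] x] bump_has_derivative)
    then have "(F t \<circ> \<phi> has_derivative
        (\<lambda>v. frechet_derivative w (at x) v + (t * dbump c r 1 x v) *\<^sub>R V)) (at x)"
      by (rule has_derivative_transform_within_open[OF _ ch(1) x])
        (use ch(2) in \<open>auto simp: F_def chart_variation_def w_def\<close>)
    from frechet_derivative_at[OF this, symmetric]
    have d: "D\<^sub>1 (F t \<circ> \<phi>) x = D\<^sub>1 w x + (t * ?h1 x) *\<^sub>R V" "D\<^sub>2 (F t \<circ> \<phi>) x = D\<^sub>2 w x + (t * ?h2 x) *\<^sub>R V"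
      by (simp_all add: D\<^sub>1_def D\<^sub>2_def)
    have "\<omega>1 (D\<^sub>1 w x) (D\<^sub>2 w x) = 0"
      using lag D x unfolding lagrangian_surface_def D\<^sub>1_def D\<^sub>2_def w_def by fast
    then have 1: "\<omega>1 (D\<^sub>1 (F t \<circ> \<phi>) x) (D\<^sub>2 (F t \<circ> \<phi>) x) = t * b' x"
      unfolding d b'_def by (simp add: \<omega>1.add_left \<omega>1.add_right \<omega>1.scaleR_left \<omega>1.scaleR_right algebra_simps)
    have 2: "\<Omega> (D\<^sub>1 (F t \<circ> \<phi>) x) (D\<^sub>2 (F t \<circ> \<phi>) x) = \<Omega>0 x + t *\<^sub>R B x"
      unfolding d B_def \<Omega>0_def
      by (simp add: \<Omega>.add_left \<Omega>.add_right \<Omega>.scaleR_left \<Omega>.scaleR_right algebra_simps)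
    have "det (first_fundamental_form (F t \<circ> \<phi>) x) = - ?R t x"
      unfolding det_first_fundamental_form 1 2 cmod_power2
      by (simp add: power2_eq_square algebra_simps)
    then show ?thesis unfolding area_density_def by (simp only: abs_minus_cancel)
  qed
  have dens_cont: "continuous_on (cbox a b) (area_density (F t \<circ> \<phi>))" for t
  proof (rule continuous_on_eq)
    show "continuous_on (cbox a b) (\<lambda>x. sqrt \<bar>?R t x\<bar>)" by (intro continuous_intros cont)
  qed (use density ab in auto)
  have int: "set_integrable lborel (cbox a b) (area_density (F t \<circ> \<phi>))" for t
    unfolding set_integrable_def by (intro borel_integrable_compact compact_cbox dens_cont)
  define area where "area t = set_lebesgue_integral lborel (cbox a b) (area_density (F t \<circ> \<phi>))" for t
  have area_eq: "area = (\<lambda>t. integral (cbox a b) (\<lambda>x. sqrt \<bar>?R t x\<bar>))"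
    unfolding area_def set_borel_integral_eq_integral(2)[OF int]
    by (intro ext integral_cong) (use density ab in auto)
  have "(area has_real_derivative
      integral (cbox a b) (\<lambda>x. Re (cnj (\<Omega>0 x) * B x) / sqrt ((cmod (\<Omega>0 x))\<^sup>2))) (at 0)"
    unfolding area_eq
    by (intro integral_sqrt_variation continuous_intros cont) (use nz ab in auto)
  moreover have "(area has_real_derivative 0) (at 0)"
  proof -
    \<comment> \<open>The box contains the ball of radius 2 r, hence the support of the bump, and
      its image can serve as the compact set of the variation.\<close>
    have "?h x = 0" if "x \<notin> cbox a b" for x
    proof (rule bump_eq_0)
      have "\<not> dist c x \<le> 2 * r" using that r(2) by (auto simp: subset_iff)
      then show "r \<le> dist c x" using r(1) by simp
    qed (use r in simp)
    then have "compactly_supported_variation M A f (\<phi> ` cbox a b) 1 F"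
      unfolding F_def
      by (intro compactly_supported_chart_variation[OF imm D _ compact_cbox ab])
        (simp add: smooth_on_def Ck_on_bump)
    \<comment> \<open>The region lies in one chart, so a decomposition into a single piece computes
      its area.\<close>
    moreover have "has_area A (F t) (\<phi> ` cbox a b) (area t)" for t
      unfolding has_area_def
      by (rule exI[of _ "{((D, \<phi>), cbox a b)}"]) (use D ab int in \<open>simp add: area_def\<close>)
    ultimately show ?thesis using min unfolding minimal_surface_def by blast
  qed
  ultimately have "integral (cbox a b) (\<lambda>x. Re (cnj (\<Omega>0 x) * B x) / sqrt ((cmod (\<Omega>0 x))\<^sup>2)) = 0"
    by (rule DERIV_unique)
  moreover have "Re (cnj (\<Omega>0 x) * B x) / sqrt ((cmod (\<Omega>0 x))\<^sup>2) = Re (cnj (sgn (\<Omega>0 x)) * B x)" for x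
    by (simp only: sgn_div_norm complex_cnj_scaleR mult_scaleR_left scaleR_complex.simps
        real_sqrt_abs abs_norm_cancel divide_inverse) (rule mult.commute)
  ultimately show ?thesis by (simp add: \<Omega>0_def B_def)
qed

section \<open>Pairs of maps of rank one\<close>

text \<open>Smoothness of powers was shown for positive bases; writing 1/f = f (f^2)^(-1) covers
  both signs.\<close>

lemma Ck_on_inverse:
  fixes f :: "'a::euclidean_space \<Rightarrow> real"
  assumes "open S" "Ck_on k S f" "\<And>x. x \<in> S \<Longrightarrow> f x \<noteq> 0"
  shows "Ck_on k S (\<lambda>x. inverse (f x))"
proof -
  note mult = Ck_on_bilinear[OF assms(1) bounded_bilinear_mult]
  have pos: "f x * f x > 0" if "x \<in> S" for x
    using assms(3)[OF that] by (simp add: zero_less_mult_iff linorder_neq_iff disj_commute)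
  have "Ck_on k S (\<lambda>x. f x * (f x * f x) powr (- 1))"
    by (rule mult[OF assms(2) Ck_on_compose[OF assms(1) open_greaterThan _ Ck_on_powr mult[OF assms(2,2)]]])
      (use pos in auto)
  moreover have "f x * (f x * f x) powr (- 1) = inverse (f x)" if "x \<in> S" for x
    using pos[OF that] assms(3)[OF that] by (simp add: powr_minus)
  ultimately show ?thesis by (subst Ck_on_cong[OF assms(1)]) auto
qed

text \<open>A bootstrap: by Cramer's rule \<open>g'\<close> is a rational expression in the partial
  derivatives of \<open>f\<close> composed with \<open>g\<close>, so \<open>g\<close> of class C^k
  has a derivative of class C^k.\<close>

lemma Ck_on_local_inverse:
  fixes f g :: "real^2 \<Rightarrow> real^2"
  assumes U: "open U" and V: "open V" and f: "smooth_on U f" and g: "g ` V \<subseteq> U"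
    and g': "\<And>y. y \<in> V \<Longrightarrow> (g has_derivative g' y) (at y)"
    and inv: "\<And>y v. y \<in> V \<Longrightarrow> frechet_derivative f (at (g y)) (g' y v) = v"
  shows "Ck_on k V g"
proof (induction k)
  case 0
  show ?case using has_derivative_continuous[OF g'] V by (simp add: continuous_on_eq_continuous_at)
next
  case (Suc k)
  let ?A = "\<lambda>y. D\<^sub>1 f (g y)" and ?B = "\<lambda>y. D\<^sub>2 f (g y)"
  let ?d = "\<lambda>y. ?A y $ 1 * ?B y $ 2 - ?A y $ 2 * ?B y $ 1"
  have lin: "linear (frechet_derivative f (at (g y)))" if "y \<in> V" for y
  proof -
    have "Ck_on (Suc 0) U f" "g y \<in> U" using f g that unfolding smooth_on_def by blast+
    then show ?thesis using Ck_on_has_derivative[OF U] has_derivative_linear by blast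
  qed
  have eq: "(g' y v)$1 * ?A y $ i + (g' y v)$2 * ?B y $ i = v $ i" if "y \<in> V" for y v i
    using arg_cong[OF linear_real2_axes[OF lin[OF that], of "g' y v", unfolded inv[OF that]], of "\<lambda>z. z $ i"]
    by (simp add: D\<^sub>1_def D\<^sub>2_def)
  have cramer: "?d y * (g' y v)$1 = v$1 * ?B y $ 2 - v$2 * ?B y $ 1"
    "?d y * (g' y v)$2 = ?A y $ 1 * v$2 - ?A y $ 2 * v$1" if "y \<in> V" for y v
    unfolding eq[OF that, of v 1, symmetric] eq[OF that, of v 2, symmetric]
    by (simp_all add: algebra_simps)
  \<comment> \<open>If the determinant vanished, Cramer's formulas for the second axis would make
    the first row of the matrix zero, and the first axis could not be in its image.\<close>
  have d: "?d y \<noteq> 0" if y: "y \<in> V" for y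
  proof
    assume d0: "?d y = 0"
    have "?A y $ 1 = 0" "?B y $ 1 = 0"
      using cramer(2)[OF y, of "vector [0, 1]", unfolded d0] cramer(1)[OF y, of "vector [0, 1]", unfolded d0]
      by simp_all
    with eq[OF y, of "vector [1, 0]" 1] show False by simp
  qed
  have comp: "Ck_on k V (\<lambda>y. frechet_derivative f (at (g y)) v $ i)" for v i
  proof -
    have "Ck_on k U (\<lambda>x. frechet_derivative f (at x) v)"
      using smooth_on_frechet_derivative[OF U f] by (simp add: smooth_on_def)
    from Ck_on_compose[OF V U g this Suc] show ?thesis
      by (rule Ck_on_linear_compose[OF V bounded_linear_vec_nth])
  qed
  have AB: "Ck_on k V (\<lambda>y. ?A y $ i)" "Ck_on k V (\<lambda>y. ?B y $ i)" for i
    unfolding D\<^sub>1_def D\<^sub>2_def by (rule comp)+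
  note mult = Ck_on_bilinear[OF V bounded_bilinear_mult]
  have diff: "Ck_on k V (\<lambda>y. a y - b y)" if "Ck_on k V a" "Ck_on k V b" for a b :: "real^2 \<Rightarrow> real"
    using Ck_on_add[OF V that(1) Ck_on_linear_compose[OF V bounded_linear_minus[OF bounded_linear_ident] that(2)]]
    by simp
  let ?g1 = "\<lambda>v y. inverse (?d y) * (v$1 * ?B y $ 2 - v$2 * ?B y $ 1)"
    and ?g2 = "\<lambda>v y. inverse (?d y) * (?A y $ 1 * v$2 - ?A y $ 2 * v$1)"
  have "Ck_on k V (\<lambda>y. ?g1 v y *\<^sub>R axis 1 1 + ?g2 v y *\<^sub>R axis 2 1 :: real^2)" for v :: "real^2"
    by (intro Ck_on_add[OF V] Ck_on_bilinear[OF V bounded_bilinear_scaleR] mult diff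
        Ck_on_inverse[OF V] AB Ck_on_const[OF V] d)
  moreover have "?g1 v y = (g' y v)$1" "?g2 v y = (g' y v)$2" if "y \<in> V" for y and v :: "real^2"
    unfolding cramer[OF that, of v, symmetric] using d[OF that] by simp_all
  then have "g' y v = ?g1 v y *\<^sub>R axis 1 1 + ?g2 v y *\<^sub>R axis 2 1" if "y \<in> V" for y v
    using that by (simp add: vec_eq_iff forall_2 axis_def)
  ultimately have "Ck_on k V (\<lambda>y. g' y v)" for v
    by (subst Ck_on_cong[OF V]) auto
  with g' show ?case by (rule Ck_on_SucI[OF V])
qed

text \<open>The inverse function theorem yields a differentiable inverse, which the bootstrap shows
  to be smooth. The identity for \<open>g'\<close> is kept as part of the result because it later
  determines kernels in the new coordinates.\<close>

lemma smooth_local_inverse: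
  fixes f :: "real^2 \<Rightarrow> real^2"
  assumes U: "open U" and f: "smooth_on U f" and x0: "x0 \<in> U"
    and inj: "\<And>v. frechet_derivative f (at x0) v = 0 \<Longrightarrow> v = 0"
  obtains U' V g g' where "open U'" "U' \<subseteq> U" "x0 \<in> U'" "open V" "homeomorphism U' V f g" "smooth_on V g"
    "\<And>y. y \<in> V \<Longrightarrow> (g has_derivative g' y) (at y)"
    "\<And>y v. y \<in> V \<Longrightarrow> frechet_derivative f (at (g y)) (g' y v) = v"
proof -
  let ?D = "\<lambda>x. frechet_derivative f (at x)"
  have f1: "Ck_on (Suc 0) U f" using f unfolding smooth_on_def by blast
  note df = Ck_on_has_derivative[OF U f1]
  define f' where "f' x = Blinfun (?D x)" for x
  have f': "blinfun_apply (f' x) = ?D x" if "x \<in> U" for x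
    unfolding f'_def using df[OF that] by (simp add: bounded_linear_Blinfun_apply has_derivative_bounded_linear)
  have lin: "linear (?D x0)" using df[OF x0] by (rule has_derivative_linear)
  then have "inj (?D x0)" using inj linear_injective_0 by blast
  then obtain L where L: "linear L" "L \<circ> ?D x0 = id" using linear_injective_left_inverse lin by blast
  define invf where "invf = Blinfun L"
  have invf: "invf o\<^sub>L f' x0 = id_blinfun"
    using L(2) by (intro blinfun_eqI)
      (simp add: invf_def f'[OF x0] bounded_linear_Blinfun_apply linear_conv_bounded_linear[symmetric] L(1) fun_eq_iff)
  have "continuous_on U f'"
  proof (rule continuous_on_blinfun_componentwise)
    fix i :: "real^2"
    show "continuous_on U (\<lambda>x. blinfun_apply (f' x) i)"
      by (rule continuous_on_eq[of _ "\<lambda>x. ?D x i"]) (use f1 f' in auto)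
  qed
  from inverse_function_theorem[OF U _ this x0 invf] f' df
  obtain U' V g g' where *: "open U'" "U' \<subseteq> U" "x0 \<in> U'" "open V" "homeomorphism U' V f g"
    and g: "\<And>y. y \<in> V \<Longrightarrow> (g has_derivative g' y) (at y)"
      "\<And>y. y \<in> V \<Longrightarrow> g' y = inv (blinfun_apply (f' (g y)))"
      "\<And>y. y \<in> V \<Longrightarrow> bij (blinfun_apply (f' (g y)))"
    by metis
  have gV: "g ` V \<subseteq> U" using * by (auto simp: homeomorphism_def)
  have inv: "?D (g y) (g' y v) = v" if "y \<in> V" for y v
    using g(2,3)[OF that] f'[of "g y"] gV that by (auto simp: bij_is_surj surj_f_inv_f)
  have "smooth_on V g"
    unfolding smooth_on_def using Ck_on_local_inverse[OF U \<open>open V\<close> f gV g(1) inv] by blast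
  with * g(1) inv show thesis by (intro that) auto
qed

section \<open>Maps of real rank one into the complex plane\<close>

text \<open>\<open>Im (a * cnj b)\<close> is, up to sign, the real area form of the complex plane;
  its vanishing means that a/b is real.\<close>

lemma real_multiple_if_Im_mult_cnj_eq_0:
  assumes "Im (a * cnj b) = 0" "b \<noteq> 0"
  obtains t :: real where "a = t *\<^sub>R b"
proof
  have "Im (a / b) = 0"
    using assms(1) unfolding complex_div_cnj[of a b] of_real_power[symmetric] Im_divide_of_real by simp
  then have "complex_of_real (Re (a / b)) = a / b" by (simp add: complex_eq_iff)
  then show "a = Re (a / b) *\<^sub>R b" using assms(2) by (simp add: scaleR_conv_of_real)
qed

text \<open>The image of \<open>L\<close> lies on a real line, and the functional given by
  \<open>e\<close> is not identically zero there, hence injective on it.\<close>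

lemma rank_one_kernel:
  assumes rank: "\<And>v v'. Im (L v * cnj (L v')) = 0"
    and e: "e \<bullet> L v' \<noteq> 0" "e \<bullet> L v = 0"
  shows "L v = 0"
proof -
  have "L v' \<noteq> 0" using e(1) by auto
  then obtain t where "L v = t *\<^sub>R L v'"
    by (rule real_multiple_if_Im_mult_cnj_eq_0[OF rank])
  with e show ?thesis by auto
qed

lemma rank_one_not_injective:
  fixes L :: "real^2 \<Rightarrow> complex"
  assumes "linear L" and rank: "\<And>v v'. Im (L v * cnj (L v')) = 0"
  obtains v where "v \<noteq> 0" "L v = 0"
proof (cases "L (axis 2 1) = 0")
  case True
  then show thesis using that[of "axis 2 1"] by (simp add: axis_eq_0_iff)
next
  case False
  then obtain t where "L (axis 1 1) = t *\<^sub>R L (axis 2 1)"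
    by (rule real_multiple_if_Im_mult_cnj_eq_0[OF rank])
  then have "L (axis 1 1 - t *\<^sub>R axis 2 1) = 0"
    by (simp add: linear_diff[OF assms(1)] linear_scale[OF assms(1)])
  moreover have "axis 1 1 - t *\<^sub>R axis 2 1 \<noteq> (0 :: real^2)"
    by (auto simp: vec_eq_iff axis_def intro!: exI[of _ 1])
  ultimately show thesis by (rule that[rotated])
qed

text \<open>In a two-dimensional domain the pulled-back area form is a determinant times its value
  on the two axes.\<close>

lemma rank_one_derivative:
  fixes X :: "real^2 \<Rightarrow> complex"
  assumes "linear (frechet_derivative X (at x))" "Im (D\<^sub>1 X x * cnj (D\<^sub>2 X x)) = 0"
  shows "Im (frechet_derivative X (at x) v * cnj (frechet_derivative X (at x) v')) = 0"
proof -
  have *: "Im ((a *\<^sub>R p + b *\<^sub>R q) * cnj (c *\<^sub>R p + d *\<^sub>R q)) = (a * d - b * c) * Im (p * cnj q)"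
    for a b c d :: real and p q :: complex
    by (simp add: algebra_simps)
  show ?thesis
    unfolding linear_real2_axes[OF assms(1), of v] linear_real2_axes[OF assms(1), of v'] *
    using assms(2) by (simp add: D\<^sub>1_def D\<^sub>2_def)
qed

text \<open>
  Two maps of rank one with transversal kernels are, in the coordinates given by suitable real
  components of them, functions of the first and of the second coordinate respectively.
\<close>

lemma rank_one_pair:
  fixes X Y :: "real^2 \<Rightarrow> complex"
  assumes D: "open D" and X: "smooth_on D X" and Y: "smooth_on D Y"
    and rX: "\<And>x. x \<in> D \<Longrightarrow> Im (D\<^sub>1 X x * cnj (D\<^sub>2 X x)) = 0"
    and rY: "\<And>x. x \<in> D \<Longrightarrow> Im (D\<^sub>1 Y x * cnj (D\<^sub>2 Y x)) = 0"
    and x0: "x0 \<in> D"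
    and inj: "\<And>v. frechet_derivative X (at x0) v = 0 \<Longrightarrow> frechet_derivative Y (at x0) v = 0 \<Longrightarrow> v = 0"
  obtains N \<Psi> a b c d \<xi> \<upsilon> e g where
    "open N" "x0 \<in> N" "N \<subseteq> D" "a < b" "c < d" "smooth_on {a<..<b} \<xi>" "smooth_on {c<..<d} \<upsilon>"
    "\<And>s. s \<in> {a<..<b} \<Longrightarrow> e \<bullet> \<xi> s = s" "\<And>t. t \<in> {c<..<d} \<Longrightarrow> g \<bullet> \<upsilon> t = t"
    "continuous_on ({a<..<b} \<times> {c<..<d}) \<Psi>" "\<Psi> ` ({a<..<b} \<times> {c<..<d}) = N"
    "\<And>s t. s \<in> {a<..<b} \<Longrightarrow> t \<in> {c<..<d} \<Longrightarrow> X (\<Psi> (s, t)) = \<xi> s"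
    "\<And>s t. s \<in> {a<..<b} \<Longrightarrow> t \<in> {c<..<d} \<Longrightarrow> Y (\<Psi> (s, t)) = \<upsilon> t"
proof -
  let ?DX = "\<lambda>x. frechet_derivative X (at x)" and ?DY = "\<lambda>x. frechet_derivative Y (at x)"
  have dX: "(X has_derivative ?DX x) (at x)" and dY: "(Y has_derivative ?DY x) (at x)" if "x \<in> D" for x
    using Ck_on_has_derivative[OF D _ that] X Y unfolding smooth_on_def by blast+
  note linX = has_derivative_linear[OF dX] and linY = has_derivative_linear[OF dY]
  note rankX = rank_one_derivative[OF linX rX] and rankY = rank_one_derivative[OF linY rY]
  \<comment> \<open>Rank one gives kernels of both derivatives. By transversality dX is nonzero on
    the kernel of dY and conversely; the image vectors \<open>e\<close> and \<open>g\<close> select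
    real components of \<open>X\<close> and \<open>Y\<close> that serve as coordinates.\<close>
  obtain p where p: "p \<noteq> 0" "?DY x0 p = 0" using rank_one_not_injective[OF linY[OF x0] rankY[OF x0 x0]] .
  obtain q where q: "q \<noteq> 0" "?DX x0 q = 0" using rank_one_not_injective[OF linX[OF x0] rankX[OF x0 x0]] .
  define e where "e = ?DX x0 p"
  define g where "g = ?DY x0 q"
  have e: "e \<noteq> 0" and g: "g \<noteq> 0" using inj p q by (auto simp: e_def g_def)
  define E :: "real \<times> real \<Rightarrow> real^2" where "E z = fst z *\<^sub>R axis 1 1 + snd z *\<^sub>R axis 2 1" for z
  have E: "E z $ 1 = fst z" "E z $ 2 = snd z" for z by (simp_all add: E_def axis_def)
  have E': "E (y $ 1, y $ 2) = y" for y by (simp add: vec_eq_iff forall_2 E)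
  have linE: "bounded_linear E" unfolding E_def[abs_def] by (intro bounded_linear_intros)
  define \<Phi> where "\<Phi> x = E (e \<bullet> X x, g \<bullet> Y x)" for x
  have \<Phi>: "\<Phi> x $ 1 = e \<bullet> X x" "\<Phi> x $ 2 = g \<bullet> Y x" for x by (simp_all add: \<Phi>_def E)
  have "smooth_on D \<Phi>"
    unfolding smooth_on_def \<Phi>_def E_def fst_conv snd_conv
    using X Y unfolding smooth_on_def
    by (intro allI Ck_on_add[OF D] Ck_on_bilinear[OF D bounded_bilinear_scaleR] Ck_on_const[OF D]
        Ck_on_linear_compose[OF D bounded_linear_inner_right]) auto
  moreover have d\<Phi>: "frechet_derivative \<Phi> (at x) v = E (e \<bullet> ?DX x v, g \<bullet> ?DY x v)" if "x \<in> D" for x v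
  proof -
    have "(\<Phi> has_derivative (\<lambda>v. E (e \<bullet> ?DX x v, g \<bullet> ?DY x v))) (at x)"
      unfolding \<Phi>_def by (intro bounded_linear.has_derivative[OF linE] has_derivative_Pair
          has_derivative_inner_right dX dY that)
    from frechet_derivative_at[OF this, symmetric] show ?thesis by simp
  qed
  \<comment> \<open>By rank one, vanishing of the selected components forces both derivatives to
    vanish, so the coordinate map is invertible at \<open>x0\<close>.\<close>
  moreover have "v = 0" if "frechet_derivative \<Phi> (at x0) v = 0" for v
  proof -
    have v: "e \<bullet> ?DX x0 v = 0" "g \<bullet> ?DY x0 v = 0"
      using that unfolding d\<Phi>[OF x0] by (simp_all add: vec_eq_iff forall_2 E)
    have pq: "e \<bullet> ?DX x0 p \<noteq> 0" "g \<bullet> ?DY x0 q \<noteq> 0" using e g by (simp_all add: e_def g_def)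
    show ?thesis
      by (rule inj rank_one_kernel[OF rankX[OF x0 x0] pq(1) v(1)] rank_one_kernel[OF rankY[OF x0 x0] pq(2) v(2)])+
  qed
  ultimately obtain U' V \<Theta> \<Theta>' where U': "open U'" "U' \<subseteq> D" "x0 \<in> U'" and V: "open V"
    and hom: "homeomorphism U' V \<Phi> \<Theta>" and sm: "smooth_on V \<Theta>"
    and d\<Theta>: "\<And>y. y \<in> V \<Longrightarrow> (\<Theta> has_derivative \<Theta>' y) (at y)"
    and inv: "\<And>y v. y \<in> V \<Longrightarrow> frechet_derivative \<Phi> (at (\<Theta> y)) (\<Theta>' y v) = v"
    using smooth_local_inverse[OF D _ x0] by metis
  have \<Theta>U: "\<Theta> y \<in> U'" and \<Phi>\<Theta>: "\<Phi> (\<Theta> y) = y" if "y \<in> V" for y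
    using hom that by (auto simp: homeomorphism_def)
  have \<Phi>V: "\<Phi> x \<in> V" and \<Theta>\<Phi>: "\<Theta> (\<Phi> x) = x" if "x \<in> U'" for x
    using hom that by (auto simp: homeomorphism_def)
  \<comment> \<open>In a box the coordinate lines are intervals, on which a vanishing derivative
    implies constancy.\<close>
  obtain l u where lu: "cbox l u \<subseteq> V" "\<Phi> x0 \<in> box l u"
    by (rule open_contains_cbox[OF V \<Phi>V[OF U'(3)]])
  let ?I = "{l$1<..<u$1}" and ?J = "{l$2<..<u$2}"
  define \<Psi> where "\<Psi> z = \<Theta> (E z)" for z
  have box: "E (s, t) \<in> box l u \<longleftrightarrow> s \<in> ?I \<and> t \<in> ?J" for s t
    by (auto simp: mem_box_cart forall_2 E)
  have boxV: "E (s, t) \<in> V" if "s \<in> ?I" "t \<in> ?J" for s t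
    using that box box_subset_cbox lu(1) by blast
  define s0 t0 where "s0 = \<Phi> x0 $ 1" and "t0 = \<Phi> x0 $ 2"
  have st0: "s0 \<in> ?I" "t0 \<in> ?J"
    using lu(2) by (auto simp: s0_def t0_def mem_box_cart)
  \<comment> \<open>Along the second coordinate vector the selected component of \<open>X\<close> is
    stationary, along the first it is not; rank one then kills the whole derivative of
    \<open>X\<close>. For \<open>Y\<close> the roles are exchanged.\<close>
  have transX: "?DX (\<Theta> y) (\<Theta>' y (axis 2 1)) = 0" and transY: "?DY (\<Theta> y) (\<Theta>' y (axis 1 1)) = 0"
    if y: "y \<in> V" for y
  proof -
    have xD: "\<Theta> y \<in> D" using \<Theta>U[OF y] U' by blast
    have 1: "e \<bullet> ?DX (\<Theta> y) (\<Theta>' y v) = v $ 1" "g \<bullet> ?DY (\<Theta> y) (\<Theta>' y v) = v $ 2" for v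
      using inv[OF y, of v] unfolding d\<Phi>[OF xD] by (simp_all add: vec_eq_iff forall_2 E)
    show "?DX (\<Theta> y) (\<Theta>' y (axis 2 1)) = 0"
      by (rule rank_one_kernel[where e = e and v' = "\<Theta>' y (axis 1 1)", OF rankX[OF xD xD]]) (simp_all add: 1 axis_def)
    show "?DY (\<Theta> y) (\<Theta>' y (axis 1 1)) = 0"
      by (rule rank_one_kernel[where e = g and v' = "\<Theta>' y (axis 2 1)", OF rankY[OF xD xD]]) (simp_all add: 1 axis_def)
  qed
  have lin\<Theta>: "linear (\<Theta>' y)" if "y \<in> V" for y using d\<Theta>[OF that] by (rule has_derivative_linear)
  have XI: "X (\<Psi> (s, t)) = X (\<Psi> (s, t0))" if "s \<in> ?I" "t \<in> ?J" for s t
  proof (rule has_derivative_zero_unique[of ?J])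
    fix r assume r: "r \<in> ?J"
    note rV = boxV[OF that(1) r]
    have xD: "\<Theta> (E (s, r)) \<in> D" using \<Theta>U[OF rV] U' by blast
    have "((\<lambda>r. E (s, r)) has_derivative (\<lambda>h. h *\<^sub>R axis 2 1)) (at r within ?J)"
      unfolding E_def fst_conv snd_conv by (auto intro!: derivative_eq_intros)
    from has_derivative_compose[OF has_derivative_compose[OF this d\<Theta>[OF rV]] dX[OF xD]]
    show "((\<lambda>r. X (\<Psi> (s, r))) has_derivative (\<lambda>h. 0)) (at r within ?J)"
      unfolding \<Psi>_def by (simp add: linear_scale[OF lin\<Theta>[OF rV]] linear_scale[OF linX[OF xD]] transX[OF rV])
  qed (use that st0 in auto)
  have YJ: "Y (\<Psi> (s, t)) = Y (\<Psi> (s0, t))" if "s \<in> ?I" "t \<in> ?J" for s t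
  proof (rule has_derivative_zero_unique[of ?I])
    fix r assume r: "r \<in> ?I"
    note rV = boxV[OF r that(2)]
    have xD: "\<Theta> (E (r, t)) \<in> D" using \<Theta>U[OF rV] U' by blast
    have "((\<lambda>r. E (r, t)) has_derivative (\<lambda>h. h *\<^sub>R axis 1 1)) (at r within ?I)"
      unfolding E_def fst_conv snd_conv by (auto intro!: derivative_eq_intros)
    from has_derivative_compose[OF has_derivative_compose[OF this d\<Theta>[OF rV]] dY[OF xD]]
    show "((\<lambda>r. Y (\<Psi> (r, t))) has_derivative (\<lambda>h. 0)) (at r within ?I)"
      unfolding \<Psi>_def by (simp add: linear_scale[OF lin\<Theta>[OF rV]] linear_scale[OF linY[OF xD]] transY[OF rV])
  qed (use that st0 in auto)
  define N where "N = {x \<in> U'. \<Phi> x \<in> box l u}"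
  have \<Psi>N: "\<Psi> ` (?I \<times> ?J) = N"
  proof (intro equalityI subsetI)
    fix x assume "x \<in> \<Psi> ` (?I \<times> ?J)"
    then show "x \<in> N" using \<Theta>U \<Phi>\<Theta> boxV box by (auto simp: N_def \<Psi>_def)
  next
    fix x assume x: "x \<in> N"
    then have "x = \<Psi> (\<Phi> x $ 1, \<Phi> x $ 2)" by (simp add: \<Psi>_def E' \<Theta>\<Phi> N_def)
    moreover have "(\<Phi> x $ 1, \<Phi> x $ 2) \<in> ?I \<times> ?J" using x by (auto simp: N_def mem_box_cart)
    ultimately show "x \<in> \<Psi> ` (?I \<times> ?J)" by blast
  qed
  have cont\<Psi>: "continuous_on (?I \<times> ?J) \<Psi>"
    unfolding \<Psi>_def
    by (rule continuous_on_compose2[of V \<Theta>])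
      (use hom boxV linear_continuous_on[OF linE] in \<open>auto simp: homeomorphism_def\<close>)
  show thesis
  proof (rule that[of N "l$1" "u$1" "l$2" "u$2" "\<lambda>s. X (\<Psi> (s, t0))" "\<lambda>t. Y (\<Psi> (s0, t))" e g \<Psi>])
    show "open N"
    proof -
      have "open (U' \<inter> \<Phi> -` box l u)"
        using hom U'(1) open_box by (intro continuous_open_preimage) (simp_all add: homeomorphism_def)
      then show ?thesis by (simp add: N_def vimage_def Int_def)
    qed
    show "x0 \<in> N" "N \<subseteq> D" using U' lu(2) by (auto simp: N_def)
    show "l$1 < u$1" "l$2 < u$2" using st0 by auto
    have smz: "Ck_on k S (\<lambda>r. Z (\<Psi> (z r)))"
      if "smooth_on D Z" "open S" "\<And>r. r \<in> S \<Longrightarrow> z r \<in> ?I \<times> ?J" "Ck_on k S (\<lambda>r. E (z r))"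
      for k S and z :: "real \<Rightarrow> real \<times> real" and Z :: "real^2 \<Rightarrow> complex"
      unfolding \<Psi>_def
      by (rule Ck_on_compose[OF that(2) D _ _ Ck_on_compose[OF that(2) V _ _ that(4)]])
        (use that sm \<Theta>U U' boxV in \<open>force simp: smooth_on_def\<close>)+
    have aff: "Ck_on k S (\<lambda>r. E (z r))" if "open S" "\<And>r. E (z r) = m + r *\<^sub>R n"
      for k S and z :: "real \<Rightarrow> real \<times> real" and m n
      unfolding that(2) using that(1)
      by (intro Ck_on_add Ck_on_const Ck_on_linear bounded_linear_scaleR_left)
    show "smooth_on ?I (\<lambda>s. X (\<Psi> (s, t0)))"
      unfolding smooth_on_def using st0
      by (intro allI smz[OF X] aff[of _ _ "t0 *\<^sub>R axis 2 1" "axis 1 1"]) (auto simp: E_def)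
    show "smooth_on ?J (\<lambda>t. Y (\<Psi> (s0, t)))"
      unfolding smooth_on_def using st0
      by (intro allI smz[OF Y] aff[of _ _ "s0 *\<^sub>R axis 1 1" "axis 2 1"]) (auto simp: E_def)
    show "e \<bullet> X (\<Psi> (s, t0)) = s" if "s \<in> ?I" for s
      using \<Phi>(1)[of "\<Psi> (s, t0)"] \<Phi>\<Theta>[OF boxV[OF that st0(2)]] by (simp add: \<Psi>_def E)
    show "g \<bullet> Y (\<Psi> (s0, t)) = t" if "t \<in> ?J" for t
      using \<Phi>(2)[of "\<Psi> (s0, t)"] \<Phi>\<Theta>[OF boxV[OF st0(1) that]] by (simp add: \<Psi>_def E)
  qed (use \<Psi>N cont\<Psi> XI YJ in auto)
qed

section \<open>Null planes\<close>

text \<open>Parametrizes the plane z2 = c cnj z1. For unimodular \<open>c\<close> this plane is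
  null, and \<open>- c\<close> gives its image under \<open>J\<close>.\<close>

definition null_lift :: "complex \<Rightarrow> complex \<Rightarrow> complex^2" where
  "null_lift c z = vector [z, c * cnj z]"

text \<open>For |c| = 1, the parameter of the projection of \<open>v\<close> to the plane of
  \<open>c\<close> along that of \<open>- c\<close>: if the two components have parameters z and z',
  then v1 = z + z' and c cnj v2 = z - z'.\<close>

definition null_coord :: "complex \<Rightarrow> complex^2 \<Rightarrow> complex" where
  "null_coord c v = (v$1 + c * cnj (v$2)) / 2"

lemma null_lift_nth [simp]: "null_lift c z $ 1 = z" "null_lift c z $ 2 = c * cnj z"
  by (simp_all add: null_lift_def)

lemma bounded_linear_null_lift: "bounded_linear (null_lift c)"
  unfolding linear_conv_bounded_linear[symmetric]
  by (rule linearI) (simp_all add: vec_eq_iff forall_2 algebra_simps)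

lemma bounded_linear_null_coord: "bounded_linear (null_coord c)"
  unfolding linear_conv_bounded_linear[symmetric]
  by (rule linearI) (simp_all add: null_coord_def complex_eq_iff algebra_simps add_divide_distrib diff_divide_distrib)

lemma null_coord_add: "null_coord c (v + w) = null_coord c v + null_coord c w"
  by (simp add: null_coord_def field_simps)

lemma unimodular: "cmod c = 1 \<Longrightarrow> c * cnj c = 1"
  by (metis complex_norm_square of_real_1 one_power2)

lemma null_coord_null_lift [simp]:
  assumes "cmod c = 1"
  shows "null_coord c (null_lift c z) = z" "null_coord c (null_lift (- c) z) = 0"
    "null_coord (- c) (null_lift c z) = 0" "null_coord (- c) (null_lift (- c) z) = z"
proof -
  have "c * (cnj c * z) = z" by (metis assms mult.assoc mult_1 unimodular)
  then show "null_coord c (null_lift c z) = z" "null_coord c (null_lift (- c) z) = 0"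
    "null_coord (- c) (null_lift c z) = 0" "null_coord (- c) (null_lift (- c) z) = z"
    by (simp_all add: null_coord_def)
qed

lemma null_decomposition:
  assumes "cmod c = 1"
  shows "null_lift c (null_coord c v) + null_lift (- c) (null_coord (- c) v) = v"
proof -
  have "c * (cnj c * z) = z" for z by (metis assms mult.assoc mult_1 unimodular)
  then show ?thesis
    by (simp add: vec_eq_iff forall_2 null_coord_def field_simps)
qed

text \<open>Conjugation in the second entry turns i into -i, so multiplication by i exchanges the
  planes of \<open>c\<close> and \<open>- c\<close>.\<close>

lemma J_null_lift: "J (null_lift c z) = null_lift (- c) (\<i> * z)"
  by (simp add: J_def vec_eq_iff forall_2)

text \<open>Used for both \<open>c\<close> and \<open>- c\<close>: on a Lagrangian tangent plane
  where \<Omega> is a real multiple of \<open>c\<close>, the right-hand side vanishes, so neither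
  coordinate has rank two.\<close>

lemma Im_null_coord_mult_cnj:
  assumes "cmod c = 1"
  shows "Im (null_coord c v * cnj (null_coord c w)) = (\<omega>1 v w + Im (cnj c * \<Omega> v w)) / 4"
proof -
  have "(Re c)\<^sup>2 + (Im c)\<^sup>2 = 1" using assms by (simp add: cmod_def)
  then show ?thesis
    unfolding null_coord_def \<omega>1_def herm1_def \<Omega>_def
    by (simp add: power2_eq_square) algebra
qed

text \<open>On the plane \<open>herm1\<close> becomes cnj z z' - z cnj z', purely imaginary but not
  zero: the metric vanishes and \<open>\<omega>1\<close> does not. The coordinates separate
  \<open>P\<close> from its image under \<open>J\<close>, and by dimension \<open>P\<close> cannot
  be complex.\<close>

lemma null_plane_range_null_lift:
  assumes "cmod c = 1"
  defines "P \<equiv> range (null_lift c)"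
  shows "null_plane P" "\<not> lagrangian_plane P" "\<not> complex_plane P" "P \<inter> J ` P = {0}"
proof -
  have lin: "linear (null_lift c)"
    by (simp add: linear_conv_bounded_linear bounded_linear_null_lift)
  have inj: "inj (null_lift c)" by (metis assms(1) injI null_coord_null_lift(1))
  have "dim P = 2" unfolding P_def using dim_image_eq[OF lin, of UNIV] inj by simp
  moreover have "subspace P" unfolding P_def using lin by (intro linear_subspace_image) auto
  moreover have "metric2 (null_lift c z) (null_lift c z') = 0" for z z'
  proof -
    have "herm1 (null_lift c z) (null_lift c z') = - (z * cnj z') + (c * cnj c) * (cnj z * z')"
      by (simp add: herm1_def)
    then show ?thesis unfolding unimodular[OF assms(1)] by (simp add: metric2_def)
  qed
  ultimately show "null_plane P" by (auto simp: null_plane_def real_plane_def P_def)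
  have "\<omega>1 (null_lift c 1) (null_lift c \<i>) \<noteq> 0"
  proof -
    have "herm1 (null_lift c 1) (null_lift c \<i>) = \<i> + (c * cnj c) * \<i>"
      by (simp add: herm1_def)
    then show ?thesis unfolding unimodular[OF assms(1)] by (simp add: \<omega>1_def)
  qed
  then show "\<not> lagrangian_plane P" by (auto simp: lagrangian_plane_def P_def)
  have zero: "null_lift d 0 = 0" for d by (simp add: vec_eq_iff forall_2)
  have JP: "J ` P = range (null_lift (- c))"
  proof -
    have "range (\<lambda>z. \<i> * z) = UNIV" by (auto intro!: surjI[of _ "\<lambda>z. - \<i> * z"])
    then show ?thesis
      unfolding P_def image_image J_null_lift by (metis image_image)
  qed
  have disj: "z = 0" if "null_lift c z = null_lift (- c) z'" for z z'
    using that null_coord_null_lift[OF assms(1)] by metis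
  show 0: "P \<inter> J ` P = {0}"
    unfolding JP unfolding P_def
  proof (intro equalityI subsetI)
    fix v assume "v \<in> range (null_lift c) \<inter> range (null_lift (- c))"
    then obtain z z' where v: "v = null_lift c z" "v = null_lift (- c) z'" by blast
    have "z = 0" using disj[of z z'] v by simp
    then show "v \<in> {0}" using v(1) zero by simp
  next
    fix v :: "complex^2" assume "v \<in> {0}"
    then have "v = null_lift c 0" "v = null_lift (- c) 0" using zero by auto
    then show "v \<in> range (null_lift c) \<inter> range (null_lift (- c))" by blast
  qed
  show "\<not> complex_plane P"
  proof
    assume "complex_plane P"
    then have "J ` P = P" by (simp add: complex_plane_def)
    with 0 \<open>dim P = 2\<close> show False by simp
  qed
qed

section \<open>Local product structure\<close>

text \<open>A linear functional that recovers the parameter takes the value 1 on the velocity, which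
  is therefore nonzero.\<close>

lemma regular_curve_image:
  fixes \<gamma> :: "real \<Rightarrow> complex^2" and m :: "complex^2 \<Rightarrow> real"
  assumes "a < b" "smooth_on {a<..<b} \<gamma>" "bounded_linear m" "\<And>s. s \<in> {a<..<b} \<Longrightarrow> m (\<gamma> s) = s"
  shows "regular_curve (\<gamma> ` {a<..<b})"
  unfolding regular_curve_def
proof (intro exI conjI ballI)
  fix s assume s: "s \<in> {a<..<b}"
  have "(\<gamma> has_derivative frechet_derivative \<gamma> (at s)) (at s)"
    using Ck_on_has_derivative[OF open_greaterThanLessThan _ s, of 0 \<gamma>] assms(2) unfolding smooth_on_def by blast
  then have d: "(\<gamma> has_vector_derivative vector_derivative \<gamma> (at s)) (at s)"
    using differentiableI vector_derivative_works by blast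
  have "((\<lambda>s. m (\<gamma> s)) has_vector_derivative m (vector_derivative \<gamma> (at s))) (at s)"
    by (rule bounded_linear.has_vector_derivative[OF assms(3) d])
  moreover have "((\<lambda>s. m (\<gamma> s)) has_vector_derivative 1) (at s)"
    by (rule has_vector_derivative_transform_within_open[of "\<lambda>s. s" _ s "{a<..<b}"])
      (use s assms(4) in \<open>auto intro: derivative_eq_intros\<close>)
  ultimately have "m (vector_derivative \<gamma> (at s)) = 1"
    by (rule vector_derivative_unique_at)
  then show "vector_derivative \<gamma> (at s) \<noteq> 0"
    using linear_0[OF bounded_linear.linear[OF assms(3)]] by force
qed (use assms in \<open>auto simp: is_interval_oo\<close>)

text \<open>The coordinates of \<open>f\<close> along \<open>P\<close> and along its image under
  \<open>J\<close> have rank one, and their derivatives are jointly injective, so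
  \<open>rank_one_pair\<close> separates the variables. Lifting the two resulting plane curves gives
  the factors.\<close>

lemma product_of_curves_if_constant_phase:
  assumes lag: "lagrangian_surface M A f" and chart: "(D, \<phi>) \<in> A" and c: "cmod c = 1"
    and D': "open D'" "D' \<subseteq> D" "x0 \<in> D'"
    and phase: "\<And>x. x \<in> D' \<Longrightarrow> Im (cnj c * \<Omega> (D\<^sub>1 (f \<circ> \<phi>) x) (D\<^sub>2 (f \<circ> \<phi>) x)) = 0"
  shows "product_of_curves_at M f (range (null_lift c)) (\<phi> x0)"
proof -
  define w where "w = f \<circ> \<phi>"
  have imm: "immersed_surface M A f" using lag by (simp add: lagrangian_surface_def)
  have M: "smooth_surface M A" using imm by (simp add: immersed_surface_def)
  note ch = chartD[OF M chart]
  have smw: "smooth_on D' w"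
  proof -
    have "smooth_on D w" using imm chart unfolding immersed_surface_def w_def by fast
    then show ?thesis using Ck_on_subset[OF _ D'(2)] unfolding smooth_on_def by blast
  qed
  have dw: "(w has_derivative frechet_derivative w (at x)) (at x)" if "x \<in> D'" for x
    using Ck_on_has_derivative[OF D'(1) _ that] smw unfolding smooth_on_def by blast
  let ?X = "\<lambda>c x. null_coord c (w x)"
  have smX: "smooth_on D' (?X d)" for d
    using smw Ck_on_linear_compose[OF D'(1) bounded_linear_null_coord] unfolding smooth_on_def by blast
  have dX: "frechet_derivative (?X d) (at x) v = null_coord d (frechet_derivative w (at x) v)"
    if "x \<in> D'" for x d v
    using frechet_derivative_at[OF bounded_linear.has_derivative[OF bounded_linear_null_coord dw[OF that]], symmetric]
    by simp
  have lagw: "\<omega>1 (D\<^sub>1 w x) (D\<^sub>2 w x) = 0" if "x \<in> D'" for x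
    using lag chart that D'(2) unfolding lagrangian_surface_def D\<^sub>1_def D\<^sub>2_def w_def by fast
  have rank: "Im (D\<^sub>1 (?X d) x * cnj (D\<^sub>2 (?X d) x)) = 0" if "x \<in> D'" "d = c \<or> d = - c" for x d
  proof -
    have "D\<^sub>1 (?X d) x = null_coord d (D\<^sub>1 w x)" "D\<^sub>2 (?X d) x = null_coord d (D\<^sub>2 w x)"
      by (simp_all add: D\<^sub>1_def D\<^sub>2_def dX[OF that(1)])
    moreover have "cmod d = 1" using c that(2) by auto
    ultimately show ?thesis
      using Im_null_coord_mult_cnj[of d "D\<^sub>1 w x" "D\<^sub>2 w x"] lagw[OF that(1)] phase[OF that(1)] that(2)
      by (auto simp: w_def)
  qed
  have inj: "v = 0" if "frechet_derivative (?X c) (at x0) v = 0" "frechet_derivative (?X (- c)) (at x0) v = 0" for v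
  proof -
    have 0: "null_lift d 0 = 0" for d by (simp add: vec_eq_iff forall_2)
    have "frechet_derivative w (at x0) v = 0"
      using null_decomposition[OF c, of "frechet_derivative w (at x0) v"] that
      unfolding dX[OF D'(3)] by (simp add: 0)
    moreover have "inj (frechet_derivative w (at x0))"
      using imm chart D' unfolding immersed_surface_def w_def by fast
    moreover have "frechet_derivative w (at x0) 0 = 0"
      using linear_0[OF has_derivative_linear[OF dw[OF D'(3)]]] .
    ultimately show ?thesis by (metis injD)
  qed
  obtain N \<Psi> a b a' b' \<xi> \<upsilon> e g where N: "open N" "x0 \<in> N" "N \<subseteq> D'"
    and ab: "a < b" "a' < b'" and sm: "smooth_on {a<..<b} \<xi>" "smooth_on {a'<..<b'} \<upsilon>"
    and e: "\<And>s. s \<in> {a<..<b} \<Longrightarrow> e \<bullet> \<xi> s = s" and g: "\<And>t. t \<in> {a'<..<b'} \<Longrightarrow> g \<bullet> \<upsilon> t = t"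
    and \<Psi>: "continuous_on ({a<..<b} \<times> {a'<..<b'}) \<Psi>" "\<Psi> ` ({a<..<b} \<times> {a'<..<b'}) = N"
    and X: "\<And>s t. s \<in> {a<..<b} \<Longrightarrow> t \<in> {a'<..<b'} \<Longrightarrow> null_coord c (w (\<Psi> (s, t))) = \<xi> s"
    and Y: "\<And>s t. s \<in> {a<..<b} \<Longrightarrow> t \<in> {a'<..<b'} \<Longrightarrow> null_coord (- c) (w (\<Psi> (s, t))) = \<upsilon> t"
    by (rule rank_one_pair[OF D'(1) smX smX rank[OF _ disjI1[OF refl]] rank[OF _ disjI2[OF refl]] D'(3) inj])
      (assumption | (rule that; (assumption | blast)))+
  let ?I = "{a<..<b}" and ?J = "{a'<..<b'}"
  define \<gamma>1 where "\<gamma>1 s = null_lift c (\<xi> s)" for s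
  \<comment> \<open>The factor - i is undone by \<open>J\<close>, which maps this curve to the lift
    of \<open>\<upsilon>\<close> to the plane of \<open>- c\<close>.\<close>
  define \<gamma>2 where "\<gamma>2 t = null_lift c (- \<i> * \<upsilon> t)" for t
  have J\<gamma>2: "J (\<gamma>2 t) = null_lift (- c) (\<upsilon> t)" for t
    by (simp add: \<gamma>2_def J_null_lift)
  have reg1: "regular_curve (\<gamma>1 ` ?I)"
  proof (rule regular_curve_image[OF ab(1), where m = "\<lambda>v. e \<bullet> null_coord c v"])
    show "smooth_on ?I \<gamma>1"
      using sm(1) unfolding smooth_on_def \<gamma>1_def
      by (intro allI Ck_on_linear_compose[OF _ bounded_linear_null_lift]) auto
    show "bounded_linear (\<lambda>v. e \<bullet> null_coord c v)"
      by (rule bounded_linear_compose[OF bounded_linear_inner_right bounded_linear_null_coord])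
  qed (simp add: \<gamma>1_def c e)
  have reg2: "regular_curve (\<gamma>2 ` ?J)"
  proof (rule regular_curve_image[OF ab(2), where m = "\<lambda>v. g \<bullet> (\<i> * null_coord c v)"])
    show "smooth_on ?J \<gamma>2"
      using sm(2) unfolding smooth_on_def \<gamma>2_def
      by (intro allI Ck_on_linear_compose[OF _ bounded_linear_compose[OF bounded_linear_null_lift
            bounded_linear_mult_right[of "- \<i>"]]]) auto
    show "bounded_linear (\<lambda>v. g \<bullet> (\<i> * null_coord c v))"
      by (rule bounded_linear_compose[OF bounded_linear_inner_right
            bounded_linear_compose[OF bounded_linear_mult_right bounded_linear_null_coord]])
  qed (simp add: \<gamma>2_def c g)
  let ?C = "curve_product (\<gamma>1 ` ?I) (\<gamma>2 ` ?J)"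
  \<comment> \<open>The inverse of \<open>w\<close>: linear functionals recover s and t from a point
    of the product, which makes continuity immediate.\<close>
  define k where "k q = \<Psi> (e \<bullet> null_coord c q, g \<bullet> null_coord (- c) q)" for q
  have C: "?C = {\<gamma>1 s + J (\<gamma>2 t) | s t. s \<in> ?I \<and> t \<in> ?J}"
    unfolding curve_product_def by blast
  have w\<Psi>: "w (\<Psi> (s, t)) = \<gamma>1 s + J (\<gamma>2 t)" if "s \<in> ?I" "t \<in> ?J" for s t
    using null_decomposition[OF c, of "w (\<Psi> (s, t))"] X[OF that] Y[OF that] by (simp add: \<gamma>1_def J\<gamma>2)
  have coords: "e \<bullet> null_coord c (\<gamma>1 s + J (\<gamma>2 t)) = s" "g \<bullet> null_coord (- c) (\<gamma>1 s + J (\<gamma>2 t)) = t"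
    if "s \<in> ?I" "t \<in> ?J" for s t
    using that e g by (simp_all add: null_coord_add \<gamma>1_def J\<gamma>2 c)
  have "homeomorphic_maps (top_of_set N) (top_of_set ?C) w k"
    unfolding homeomorphic_maps_def
  proof (intro conjI ballI)
    have "continuous_on N w"
      using Ck_on_continuous_on[OF D'(1)] smw N(3) continuous_on_subset unfolding smooth_on_def by blast
    moreover have "w ` N \<subseteq> ?C" unfolding C \<Psi>(2)[symmetric] using w\<Psi> by blast
    ultimately show "continuous_map (top_of_set N) (top_of_set ?C) w" by auto
    have "continuous_on ?C k"
      unfolding k_def
    proof (rule continuous_on_compose2[OF \<Psi>(1)])
      show "continuous_on ?C (\<lambda>q. (e \<bullet> null_coord c q, g \<bullet> null_coord (- c) q))"
        by (intro continuous_intros bounded_linear.continuous_on[OF bounded_linear_null_coord])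
      show "(\<lambda>q. (e \<bullet> null_coord c q, g \<bullet> null_coord (- c) q)) ` ?C \<subseteq> ?I \<times> ?J"
        unfolding C using coords by auto
    qed
    moreover have "k ` ?C \<subseteq> N" unfolding C \<Psi>(2)[symmetric] k_def using coords by auto
    ultimately show "continuous_map (top_of_set ?C) (top_of_set N) k" by auto
    show "k (w x) = x" if "x \<in> topspace (top_of_set N)" for x
      using that unfolding topspace_euclidean_subtopology \<Psi>(2)[symmetric]
      by (auto simp: w\<Psi> coords k_def)
    show "w (k q) = q" if "q \<in> topspace (top_of_set ?C)" for q
      using that unfolding topspace_euclidean_subtopology C by (auto simp: k_def coords w\<Psi>)
  qed
  \<comment> \<open>The chart restricts to a homeomorphism from \<open>N\<close> onto its image,
    which transfers the result from \<open>w\<close> to \<open>f\<close>.\<close>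
  moreover obtain \<phi>' where \<phi>': "homeomorphic_maps (top_of_set N) (subtopology M (\<phi> ` N)) \<phi> \<phi>'"
  proof -
    have ND: "N \<subseteq> D" using N D' by blast
    have "homeomorphic_map (subtopology (top_of_set D) N) (subtopology (subtopology M (\<phi> ` D)) (\<phi> ` N)) \<phi>"
    proof (rule homeomorphic_map_subtopologies[OF ch(4)])
      have "\<phi> ` D \<subseteq> topspace M" using openin_subset[OF ch(3)] .
      then show "\<phi> ` (topspace (top_of_set D) \<inter> N) = topspace (subtopology M (\<phi> ` D)) \<inter> \<phi> ` N"
        using ND by (auto simp: Int_absorb1)
    qed
    moreover have "D \<inter> N = N" "\<phi> ` D \<inter> \<phi> ` N = \<phi> ` N" using ND by auto
    ultimately show thesis
      using that by (auto simp: subtopology_subtopology homeomorphic_map_maps)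
  qed
  ultimately have "homeomorphic_maps (subtopology M (\<phi> ` N)) (top_of_set ?C) (w \<circ> \<phi>') (\<phi> \<circ> k)"
    using homeomorphic_maps_compose homeomorphic_maps_sym by blast
  then have "homeomorphic_map (subtopology M (\<phi> ` N)) (top_of_set ?C) (w \<circ> \<phi>')"
    by (rule homeomorphic_maps_imp_map)
  then have "homeomorphic_map (subtopology M (\<phi> ` N)) (top_of_set ?C) f"
  proof (rule homeomorphic_map_eq)
    fix p assume "p \<in> topspace (subtopology M (\<phi> ` N))"
    then show "(w \<circ> \<phi>') p = f p"
      using \<phi>' unfolding homeomorphic_maps_def by (auto simp: w_def)
  qed
  moreover have "openin M (\<phi> ` N)"
    using openin_chart_image[OF M chart N(1)] N(3) D'(2) by blast
  ultimately show ?thesis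
    unfolding product_of_curves_at_def using N(2) reg1 reg2
    by (intro exI[of _ "\<phi> ` N"] exI[of _ "\<gamma>1 ` ?I"] exI[of _ "\<gamma>2 ` ?J"]) (auto simp: \<gamma>1_def \<gamma>2_def)
qed

section \<open>The phase of the tangent planes\<close>

text \<open>Says that \<Omega> on the tangent plane is a real multiple of \<open>c\<close>. Fixing
  the phase only up to sign makes it independent of orientation, hence a property of the point and
  not of the chart.\<close>

definition has_phase :: "'a chart set \<Rightarrow> ('a \<Rightarrow> complex^2) \<Rightarrow> complex \<Rightarrow> 'a \<Rightarrow> bool" where
  "has_phase A f c p \<longleftrightarrow> (\<exists>(D, \<phi>) \<in> A. \<exists>x\<in>D. p = \<phi> x \<and>
     Im (cnj c * \<Omega> (D\<^sub>1 (f \<circ> \<phi>) x) (D\<^sub>2 (f \<circ> \<phi>) x)) = 0)"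

text \<open>A change of chart multiplies \<Omega> by a real Jacobian determinant.\<close>

lemma has_phase_iff:
  assumes imm: "immersed_surface M A f" and D: "(D, \<phi>) \<in> A" "x \<in> D"
  shows "has_phase A f c (\<phi> x) \<longleftrightarrow> Im (cnj c * \<Omega> (D\<^sub>1 (f \<circ> \<phi>) x) (D\<^sub>2 (f \<circ> \<phi>) x)) = 0"
proof
  assume "has_phase A f c (\<phi> x)"
  then obtain E \<psi> y where E: "(E, \<psi>) \<in> A" "y \<in> E" and xy: "\<phi> x = \<psi> y"
    and 0: "Im (cnj c * \<Omega> (D\<^sub>1 (f \<circ> \<psi>) y) (D\<^sub>2 (f \<circ> \<psi>) y)) = 0"
    unfolding has_phase_def by blast
  have M: "smooth_surface M A" using imm by (simp add: immersed_surface_def)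
  note chD = chartD[OF M D(1)] and chE = chartD[OF M E(1)]
  let ?\<tau> = "inv_into E \<psi> \<circ> \<phi>"
  let ?D1 = "{z \<in> D. \<phi> z \<in> \<psi> ` E}"
  have o1: "open ?D1" by (rule open_chart_preimage[OF M D(1) chE(3)])
  have x1: "x \<in> ?D1" using D(2) E(2) xy by auto
  have \<tau>x: "?\<tau> x = y" using chE(2) E(2) xy by simp
  have "smooth_on ?D1 ?\<tau>" using M D(1) E(1) unfolding smooth_surface_def by fast
  then have d\<tau>: "(?\<tau> has_derivative frechet_derivative ?\<tau> (at x)) (at x)"
    using Ck_on_has_derivative[OF o1 _ x1] unfolding smooth_on_def by blast
  have "smooth_on E (f \<circ> \<psi>)" using imm E(1) unfolding immersed_surface_def by fast
  then have "(f \<circ> \<psi> has_derivative frechet_derivative (f \<circ> \<psi>) (at y)) (at y)"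
    using Ck_on_has_derivative[OF chE(1) _ E(2)] unfolding smooth_on_def by blast
  then have "((\<lambda>z. (f \<circ> \<psi>) (?\<tau> z)) has_derivative
      (\<lambda>v. frechet_derivative (f \<circ> \<psi>) (at y) (frechet_derivative ?\<tau> (at x) v))) (at x)"
    using has_derivative_compose[OF d\<tau>, unfolded \<tau>x] by blast
  then have "(f \<circ> \<phi> has_derivative
      (\<lambda>v. frechet_derivative (f \<circ> \<psi>) (at y) (frechet_derivative ?\<tau> (at x) v))) (at x)"
    by (rule has_derivative_transform_within_open[OF _ o1 x1]) (auto simp: f_inv_into_f)
  note chain = frechet_derivative_at[OF this, symmetric]
  obtain a b a' b' where
    "D\<^sub>1 (f \<circ> \<phi>) x = a *\<^sub>R D\<^sub>1 (f \<circ> \<psi>) y + b *\<^sub>R D\<^sub>2 (f \<circ> \<psi>) y"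
    "D\<^sub>2 (f \<circ> \<phi>) x = a' *\<^sub>R D\<^sub>1 (f \<circ> \<psi>) y + b' *\<^sub>R D\<^sub>2 (f \<circ> \<psi>) y"
    unfolding D\<^sub>1_def[of "f \<circ> \<phi>"] D\<^sub>2_def[of "f \<circ> \<phi>"] chain chart_derivative_axes[OF imm E] by blast
  moreover have "\<Omega> (a *\<^sub>R p + b *\<^sub>R q) (a' *\<^sub>R p + b' *\<^sub>R q) = (a * b' - b * a') *\<^sub>R \<Omega> p q" for p q
  proof -
    have "\<Omega> q p = - \<Omega> p q" by (simp add: \<Omega>_def)
    then show ?thesis
      by (simp add: \<Omega>.add_left \<Omega>.add_right \<Omega>.scaleR_left \<Omega>.scaleR_right algebra_simps)
  qed
  ultimately show "Im (cnj c * \<Omega> (D\<^sub>1 (f \<circ> \<phi>) x) (D\<^sub>2 (f \<circ> \<phi>) x)) = 0"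
    using 0 by simp
qed (use D in \<open>auto simp: has_phase_def\<close>)

text \<open>The first variation makes the normalised \<Omega> constant on a ball in the chart, and
  the phase condition depends only on it. One radius serves every \<open>c\<close>.\<close>

lemma phase_locally_constant:
  assumes min: "minimal_surface M A f" and lag: "lagrangian_surface M A f"
    and D: "(D, \<phi>) \<in> A" "x0 \<in> D"
  obtains r where "0 < r" "ball x0 r \<subseteq> D"
    "\<And>x c. x \<in> ball x0 r \<Longrightarrow> has_phase A f c (\<phi> x) \<longleftrightarrow> has_phase A f c (\<phi> x0)"
proof -
  let ?w = "f \<circ> \<phi>"
  let ?\<Omega> = "\<lambda>x. \<Omega> (D\<^sub>1 ?w x) (D\<^sub>2 ?w x)"
  have imm: "immersed_surface M A f" using lag by (simp add: lagrangian_surface_def)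
  have nd: "nondegenerate_surface M A f" using min by (simp add: minimal_surface_def)
  have "smooth_surface M A" using imm by (simp add: immersed_surface_def)
  then have oD: "open D" using chartD(1) D(1) by blast
  then obtain r where r: "0 < r" "ball x0 r \<subseteq> D" using D(2) open_contains_ball by blast
  have w: "Ck_on 2 D ?w" using imm D(1) unfolding immersed_surface_def smooth_on_def by fast
  note nz = nondegenerate_lagrangian_\<Omega>_nonzero[OF nd lag D(1)]
  note der = critical_imp_phase_derivative_0[OF oD w nz minimal_lagrangian_critical[OF min lag D(1)]]
  have const: "sgn (?\<Omega> x) = sgn (?\<Omega> x0)" if "x \<in> ball x0 r" for x
  proof (rule has_derivative_zero_unique[of "ball x0 r"])
    fix z assume "z \<in> ball x0 r"
    then show "((\<lambda>x. sgn (?\<Omega> x)) has_derivative (\<lambda>h. 0)) (at z within ball x0 r)"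
      using der[of z] r has_derivative_at_withinI by blast
  qed (use that r in auto)
  have "Im (cnj c * ?\<Omega> x) = 0 \<longleftrightarrow> Im (cnj c * sgn (?\<Omega> x)) = 0" if "x \<in> D" for x c
    using nz[OF that] by (simp add: sgn_div_norm field_simps flip: right_diff_distrib)
  then have iff: "has_phase A f c (\<phi> x) \<longleftrightarrow> Im (cnj c * sgn (?\<Omega> x)) = 0" if "x \<in> D" for x c
    using has_phase_iff[OF imm D(1) that] that by blast
  have "has_phase A f c (\<phi> x) \<longleftrightarrow> has_phase A f c (\<phi> x0)" if "x \<in> ball x0 r" for x c
    unfolding iff[OF subsetD[OF r(2) that]] iff[OF D(2)] const[OF that] ..
  with r show thesis by (rule that)
qed

theorem theorem2:
  fixes M :: "'a topology" and A :: "'a chart set" and f :: "'a \<Rightarrow> complex^2"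
  assumes "minimal_surface M A f"
    and "lagrangian_surface M A f"
  shows "\<forall>C \<in> connected_components_of M. \<exists>P.
           null_plane P \<and> \<not> lagrangian_plane P \<and> \<not> complex_plane P \<and> P \<inter> J ` P = {0} \<and>
           (\<forall>p\<in>C. product_of_curves_at M f P p)"
proof
  fix C assume C: "C \<in> connected_components_of M"
  note min = assms(1) and lag = assms(2)
  have imm: "immersed_surface M A f" using lag by (simp add: lagrangian_surface_def)
  have nd: "nondegenerate_surface M A f" using min by (simp add: minimal_surface_def)
  have M: "smooth_surface M A" using imm by (simp add: immersed_surface_def)
  have charts: "\<exists>D \<phi> x. (D, \<phi>) \<in> A \<and> x \<in> D \<and> p = \<phi> x" if "p \<in> topspace M" for p
    using M that unfolding smooth_surface_def by auto
  have CM: "C \<subseteq> topspace M" and "C \<noteq> {}" and conn: "connectedin M C"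
    using connected_components_of_subset[OF C] nonempty_connected_components_of[OF C]
      connectedin_connected_components_of[OF C] by simp_all
  then obtain p0 where p0: "p0 \<in> C" by blast
  obtain D0 \<phi>0 x0 where D0: "(D0, \<phi>0) \<in> A" "x0 \<in> D0" "p0 = \<phi>0 x0"
    using charts p0 CM by blast
  \<comment> \<open>The phase at a single point fixes the null plane for the whole
    component.\<close>
  define c where "c = sgn (\<Omega> (D\<^sub>1 (f \<circ> \<phi>0) x0) (D\<^sub>2 (f \<circ> \<phi>0) x0))"
  have c: "cmod c = 1"
    using nondegenerate_lagrangian_\<Omega>_nonzero[OF nd lag D0(1,2)] by (simp add: c_def norm_sgn)
  have "Im (cnj (sgn z) * z) = 0" for z
    by (simp add: sgn_div_norm field_simps)
  then have phase0: "has_phase A f c p0"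
    using has_phase_iff[OF imm D0(1,2)] D0(3) by (simp add: c_def)
  \<comment> \<open>Points with and without phase \<open>c\<close> form two complementary open sets;
    the connected \<open>C\<close> meets the first at \<open>p0\<close>, so it lies inside
    it.\<close>
  define W where "W b = {p \<in> topspace M. has_phase A f c p = b}" for b
  have openW: "openin M (W b)" for b
  proof (subst openin_subopen, intro ballI)
    fix p assume p: "p \<in> W b"
    then obtain D \<phi> x where D: "(D, \<phi>) \<in> A" "x \<in> D" "p = \<phi> x"
      using charts unfolding W_def by blast
    obtain r where r: "0 < r" "ball x r \<subseteq> D"
      "\<And>z c. z \<in> ball x r \<Longrightarrow> has_phase A f c (\<phi> z) \<longleftrightarrow> has_phase A f c (\<phi> x)"
      using phase_locally_constant[OF min lag D(1,2)] by blast
    have op: "openin M (\<phi> ` ball x r)"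
      by (rule openin_chart_image[OF M D(1) open_ball r(2)])
    have "\<phi> ` ball x r \<subseteq> W b"
      using openin_subset[OF op] r(3)[of _ c] p D(3) by (auto simp: W_def)
    then show "\<exists>T. openin M T \<and> p \<in> T \<and> T \<subseteq> W b"
      using op r(1) D(3) by (intro exI[of _ "\<phi> ` ball x r"]) auto
  qed
  have "topspace M - W True = W False" by (auto simp: W_def)
  then have "closedin M (W True)"
    using openW[of False] by (simp add: closedin_def) (simp add: W_def)
  from connectedin_clopen_cases[OF conn this openW]
  have "C \<subseteq> W True" using p0 phase0 CM by (auto simp: W_def disjnt_iff)
  then have phase: "has_phase A f c p" if "p \<in> C" for p using that by (auto simp: W_def)
  have "product_of_curves_at M f (range (null_lift c)) p" if p: "p \<in> C" for p
  proof -
    obtain D \<phi> x where D: "(D, \<phi>) \<in> A" "x \<in> D" "p = \<phi> x"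
      using charts p CM by blast
    obtain r where r: "0 < r" "ball x r \<subseteq> D"
      "\<And>z c. z \<in> ball x r \<Longrightarrow> has_phase A f c (\<phi> z) \<longleftrightarrow> has_phase A f c (\<phi> x)"
      using phase_locally_constant[OF min lag D(1,2)] by blast
    have "Im (cnj c * \<Omega> (D\<^sub>1 (f \<circ> \<phi>) z) (D\<^sub>2 (f \<circ> \<phi>) z)) = 0" if "z \<in> ball x r" for z
      using has_phase_iff[OF imm D(1), of z c] r(2) r(3)[OF that] phase[OF p] D(3) that by auto
    from product_of_curves_if_constant_phase[OF lag D(1) c open_ball r(2) _ this] r(1)
    show ?thesis by (simp add: D(3))
  qed
  then show "\<exists>P. null_plane P \<and> \<not> lagrangian_plane P \<and> \<not> complex_plane P \<and> P \<inter> J ` P = {0} \<and>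
      (\<forall>p\<in>C. product_of_curves_at M f P p)"
    using null_plane_range_null_lift[OF c] by blast
qed

end
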